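(* Let $N\ge3$ be odd, $q=e^{\pi\mathbf{i}/N}$ and $a\in\mathbb{C}\setminus\{0\}$. For every $(1,1)$-tangle $\mathcal{K}$, the invariant $T_{a,N}(\mathcal{K})$ defined by the semicyclic representations $\rho_{a,i}$ ($i\in\{0,\dots,N-1\}$) equals Kashaev's invariant $\langle \mathcal{K}\rangle_N$, both evaluated at the $2N$-th root of unity $q$.
   Context: Throughout, $\mathbf{i}=\sqrt{-1}$, $N\ge3$ is odd, $q=e^{\pi\mathbf{i}/N}$, $[l]=\frac{q^l-q^{-l}}{q-q^{-1}}$, $[0]!=1$, $[n]!=[n][n-1]!$. $U_q(sl_2)$ is the complex algebra generated by $K,K^{-1},E,F$ with $KK^{-1}=K^{-1}K=1$, $KE=q^2EK$, $KF=q^{-2}FK$, $EF-FE=\frac{K-K^{-1}}{q-q^{-1}}$. Let $V$ have basis $v_0,\dots,v_{N-1}$ with dual basis $v^0,\dots,v^{N-1}$, and for $m\in\mathbb{Z}$ let $\overline m\in\{0,\dots,N-1\}$ be its remainder mod $N$. Semicyclic representation $\rho_{a,i}$ on $V$: $\rho_{a,i}(K)v_k=q^{1-N+2(k-i)}v_k$; $\rho_{a,i}(E)v_k=v_{k+1}$ for $k<N-1$, $\rho_{a,i}(E)v_{N-1}=av_0$; and for $k\in\{0,\dots,N-1\}$, $\rho_{a,i}(F)v_{\overline{i+k}}=[k][N-k]v_{\overline{i+k-1}}$ if $\overline{i+k}\ne0$, and $\rho_{a,i}(F)v_{\overline{i+k}}=\frac{[k][N-k]}{a}v_{\overline{i+k-1}}$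 if $\overline{i+k}=0$. These are isomorphic for different $i$. Standard $N$-dimensional irreducible representation $\rho_0$ on $V$: $\rho_0(K)v_k=q^{1-N+2k}v_k$; $\rho_0(E)v_k=v_{k+1}$ for $k<N-1$, $\rho_0(E)v_{N-1}=0$; $\rho_0(F)v_k=[k][N-k]v_{k-1}$ (so $\rho_0(F)v_0=0$). $R$-matrix in a representation $\rho$ ($\rho=\rho_{a,i}$ or $\rho_0$): with $E,F,K$ denoting their images under $\rho$, $R=q^{\frac{H\otimes H}{2}}\sum_{l=0}^{N-1}\frac{(q-q^{-1})^l}{[l]!}q^{\frac{l(l-1)}{2}}E^l\otimes F^l$ on $V\otimes V$, where $K=q^H$ and $q^{\frac{H\otimes H}{2}}(v_j\otimes v_k)=q^{h_jh_k/2}v_j\otimes v_k$ with $h_k=1-N+2(k-i)$ for $\rho_{a,i}$ and $h_k=1-N+2k$ for $\rho_0$. $\check R$ is $R$ followed by the flip $x\otimes y\mapsto y\otimes x$. Operator of a tangle in $\rho$: tangles are oriented and framed; diagrams carry the blackboard framing and are read from bottom to top. A boundary point on a strand directed downward is assigned $V$, on one directed upward $V^*$; a row of points is assigned the tensor product from left to right. Take a generic diagram with both strands directed downward at every crossing (any tangle has one), cut it into horizontal slices each containing one elementary piece next to vertical strands (identity operators), and compose the operators: cup oriented left to right, $1\mapsto\sum_jv_j\otimes v^j\in V\otimes V^*$; cup oriented right to left, $1\mapsto\sum_jv^j\otimes K^{-1}v_j\in V^*\otimes V$; cap oriented left to right, $\phi\otimes v\mapsto\phi(v)$; cap oriented right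 to left, $v\otimes\phi\mapsto\phi(Kv)$; positive crossing, $\check R$; negative crossing, $\check R^{-1}$. A $(1,1)$-tangle has one bottom and one top endpoint; its open strand is taken directed downward, so the operator lies in $\mathrm{End}(V)$ (it is a scalar multiple of the identity, and the invariant is identified with that scalar). $T_{a,N}(\mathcal{K})$ is this operator for $\rho=\rho_{a,i}$. Kashaev's invariant $\langle\mathcal{K}\rangle_N$ is the one calculated in the same way with $\rho=\rho_0$. *)

theory Defs
  imports
    "HOL-Analysis.Complex_Transcendental"
    "Jordan_Normal_Form.Gauss_Jordan_Elimination"
begin

definition q_root :: "nat \<Rightarrow> complex" where
  "q_root N = exp (complex_of_real pi * \<i> / of_nat N)"

definition qint :: "nat \<Rightarrow> nat \<Rightarrow> complex" where
  "qint N l = (q_root N powi int l - q_root N powi (- int l)) / (q_root N - inverse (q_root N))"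

fun qfact :: "nat \<Rightarrow> nat \<Rightarrow> complex" where
  "qfact N 0 = 1"
| "qfact N (Suc n) = qint N (Suc n) * qfact N n"

text \<open>
  Linear maps are represented by their matrices: column \<open>c\<close> is the image of the \<open>c\<close>-th basis
  vector.  The basis of a tensor product is ordered lexicographically, so \<open>v\<^sub>j \<otimes> v\<^sub>k\<close> in
  \<open>V \<otimes> V\<close> has index \<open>j * N + k\<close>, and the tensor product of maps is the Kronecker product.
  \<open>V*\<close> is given the dual basis.
\<close>

definition kron :: "complex mat \<Rightarrow> complex mat \<Rightarrow> complex mat" where
  "kron A B = Matrix.mat (dim_row A * dim_row B) (dim_col A * dim_col B)
     (\<lambda>(r, c). A $$ (r div dim_row B, c div dim_col B) * B $$ (r mod dim_row B, c mod dim_col B))"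

text \<open>
  The weight \<open>h\<^sub>k\<close> determines both \<open>K\<close> and \<open>H\<close>: \<open>K v\<^sub>k = q ^ h\<^sub>k v\<^sub>k\<close> with \<open>K = q ^ H\<close>.
\<close>

record uq_rep =
  rep_wt :: "nat \<Rightarrow> int"
  rep_E :: "complex mat"
  rep_F :: "complex mat"

text \<open>
  In column \<open>c\<close> of \<open>F\<close> below, \<open>k = (c - i) mod N\<close>, i.e. \<open>c\<close> is the residue of \<open>i + k\<close>;
  \<open>N\<close> is added first because the subtraction is on naturals.  The parameter satisfies \<open>i < N\<close>.
\<close>

definition semicyclic_rep :: "nat \<Rightarrow> complex \<Rightarrow> nat \<Rightarrow> uq_rep" where
  "semicyclic_rep N a i =
    \<lparr> rep_wt = (\<lambda>k. 1 - int N + 2 * (int k - int i)),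
      rep_E = Matrix.mat N N (\<lambda>(r, c).
        if c < N - 1 then (if r = c + 1 then 1 else 0) else (if r = 0 then a else 0)),
      rep_F = Matrix.mat N N (\<lambda>(r, c).
        let k = (c + N - i) mod N in
        if r = (c + N - 1) mod N
        then (if c \<noteq> 0 then qint N k * qint N (N - k) else qint N k * qint N (N - k) / a)
        else 0) \<rparr>"

definition standard_rep :: "nat \<Rightarrow> uq_rep" where
  "standard_rep N =
    \<lparr> rep_wt = (\<lambda>k. 1 - int N + 2 * int k),
      rep_E = Matrix.mat N N (\<lambda>(r, c). if r = c + 1 then 1 else 0),
      rep_F = Matrix.mat N N (\<lambda>(r, c). if r + 1 = c then qint N c * qint N (N - c) else 0) \<rparr>"

text \<open>
  Below, \<open>powr\<close> uses the principal logarithm; since \<open>Ln (q_root N) = pi * \<i> / N\<close>, the exponent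
  \<open>h\<^sub>j h\<^sub>k / 2\<close> is interpreted as usual.
\<close>

definition q_HH_half :: "nat \<Rightarrow> uq_rep \<Rightarrow> complex mat" where
  "q_HH_half N \<rho> = Matrix.mat (N * N) (N * N) (\<lambda>(r, c).
     if r = c then q_root N powr (of_int (rep_wt \<rho> (c div N) * rep_wt \<rho> (c mod N)) / 2) else 0)"

definition quasi_R :: "nat \<Rightarrow> uq_rep \<Rightarrow> complex mat" where
  "quasi_R N \<rho> = Matrix.mat (N * N) (N * N) (\<lambda>(r, c).
     \<Sum>l<N. (q_root N - inverse (q_root N)) ^ l / qfact N l * q_root N ^ (l * (l - 1) div 2)
            * kron (rep_E \<rho> ^\<^sub>m l) (rep_F \<rho> ^\<^sub>m l) $$ (r, c))"

definition R_matrix :: "nat \<Rightarrow> uq_rep \<Rightarrow> complex mat" where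
  "R_matrix N \<rho> = q_HH_half N \<rho> * quasi_R N \<rho>"

definition flip_mat :: "nat \<Rightarrow> complex mat" where
  "flip_mat N = Matrix.mat (N * N) (N * N) (\<lambda>(r, c). if r = (c mod N) * N + c div N then 1 else 0)"

definition R_check :: "nat \<Rightarrow> uq_rep \<Rightarrow> complex mat" where
  "R_check N \<rho> = flip_mat N * R_matrix N \<rho>"

text \<open>
  A boundary point is \<open>Down\<close> (assigned \<open>V\<close>) or \<open>Up\<close> (assigned \<open>V*\<close>).  Pieces are named by the
  direction in which they are traversed: \<open>CupLR\<close> is the cup oriented left to right.  Both strands
  of a crossing are directed downward.
\<close>

datatype strand = Down | Up

datatype piece = CupLR | CupRL | CapLR | CapRL | PosCrossing | NegCrossing

fun piece_bottom :: "piece \<Rightarrow> strand list" where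
  "piece_bottom CupLR = []"
| "piece_bottom CupRL = []"
| "piece_bottom CapLR = [Up, Down]"
| "piece_bottom CapRL = [Down, Up]"
| "piece_bottom PosCrossing = [Down, Down]"
| "piece_bottom NegCrossing = [Down, Down]"

fun piece_top :: "piece \<Rightarrow> strand list" where
  "piece_top CupLR = [Down, Up]"
| "piece_top CupRL = [Up, Down]"
| "piece_top CapLR = []"
| "piece_top CapRL = []"
| "piece_top PosCrossing = [Down, Down]"
| "piece_top NegCrossing = [Down, Down]"

text \<open>
  A slice is one elementary piece with vertical strands to its left and right; a sliced diagram
  is the list of its slices from bottom to top.
\<close>

type_synonym slice = "strand list \<times> piece \<times> strand list"

fun slice_bottom :: "slice \<Rightarrow> strand list" where
  "slice_bottom (ls, p, rs) = ls @ piece_bottom p @ rs"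

fun slice_top :: "slice \<Rightarrow> strand list" where
  "slice_top (ls, p, rs) = ls @ piece_top p @ rs"

fun tangle_diagram :: "strand list \<Rightarrow> slice list \<Rightarrow> strand list \<Rightarrow> bool" where
  "tangle_diagram s [] t \<longleftrightarrow> s = t"
| "tangle_diagram s (x # D) t \<longleftrightarrow> s = slice_bottom x \<and> tangle_diagram (slice_top x) D t"

definition one_one_tangle_diagram :: "slice list \<Rightarrow> bool" where
  "one_one_tangle_diagram D \<longleftrightarrow> tangle_diagram [Down] D [Down]"

text \<open>
  The cup from right to left is the vector with \<open>v\<^sup>j \<otimes> v\<^sub>k\<close>-coordinate the \<open>k\<close>-th coordinate of
  \<open>K\<^bsup>-1\<^esup> v\<^sub>j\<close>; the cap from right to left sends \<open>v\<^sub>j \<otimes> v\<^sup>k\<close> to \<open>v\<^sup>k (K v\<^sub>j)\<close>.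
\<close>

fun piece_op :: "nat \<Rightarrow> uq_rep \<Rightarrow> piece \<Rightarrow> complex mat" where
  "piece_op N \<rho> CupLR = Matrix.mat (N * N) 1 (\<lambda>(r, c). if r div N = r mod N then 1 else 0)"
| "piece_op N \<rho> CupRL = Matrix.mat (N * N) 1 (\<lambda>(r, c).
     if r div N = r mod N then q_root N powi (- rep_wt \<rho> (r div N)) else 0)"
| "piece_op N \<rho> CapLR = Matrix.mat 1 (N * N) (\<lambda>(r, c). if c div N = c mod N then 1 else 0)"
| "piece_op N \<rho> CapRL = Matrix.mat 1 (N * N) (\<lambda>(r, c).
     if c div N = c mod N then q_root N powi (rep_wt \<rho> (c div N)) else 0)"
| "piece_op N \<rho> PosCrossing = R_check N \<rho>"
| "piece_op N \<rho> NegCrossing = the (mat_inverse (R_check N \<rho>))"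

fun slice_op :: "nat \<Rightarrow> uq_rep \<Rightarrow> slice \<Rightarrow> complex mat" where
  "slice_op N \<rho> (ls, p, rs) =
     kron (1\<^sub>m (N ^ length ls)) (kron (piece_op N \<rho> p) (1\<^sub>m (N ^ length rs)))"

fun diagram_op :: "nat \<Rightarrow> uq_rep \<Rightarrow> strand list \<Rightarrow> slice list \<Rightarrow> complex mat" where
  "diagram_op N \<rho> s [] = 1\<^sub>m (N ^ length s)"
| "diagram_op N \<rho> s (x # D) = diagram_op N \<rho> (slice_top x) D * slice_op N \<rho> x"

text \<open>
  The invariant of a (1,1)-tangle is an operator on \<open>V\<close>, computed from any diagram of the tangle
  as above; the blackboard framing makes the diagram determine the framed tangle.
\<close>

definition semicyclic_invariant :: "nat \<Rightarrow> complex \<Rightarrow> nat \<Rightarrow> slice list \<Rightarrow> complex mat" where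
  "semicyclic_invariant N a i D = diagram_op N (semicyclic_rep N a i) [Down] D"

definition kashaev_invariant :: "nat \<Rightarrow> slice list \<Rightarrow> complex mat" where
  "kashaev_invariant N D = diagram_op N (standard_rep N) [Down] D"

end

theory Submission
  imports Defs "Jordan_Normal_Form.Determinant"
begin

text \<open>Write \<open>\<rho>\<^sub>b\<close> for the semicyclic representation with shift \<open>0\<close> and parameter \<open>b\<close>.  In it
  \<open>F v\<^sub>0 = 0\<close>, so the parameter enters only through \<open>E v\<^bsub>N-1\<^esub> = b v\<^sub>0\<close>; hence \<open>\<rho>\<^sub>b\<close> makes sense
  for \<open>b = 0\<close>, where it is the standard representation.  Let \<open>T\<^sub>b\<close> be the operator of the diagram
  in \<open>\<rho>\<^sub>b\<close>, and \<open>T\<close> its operator in the semicyclic representation with parameter \<open>a\<close> and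
  shift \<open>i\<close>.

  Comparison of \<open>T\<close> with \<open>T\<^sub>b\<close> for \<open>b \<noteq> 0\<close>.  If \<open>a = s^N b\<close>, the monomial map \<open>G\<close> sending \<open>v\<^sub>k\<close> to a multiple
  of \<open>v\<^bsub>i+k\<^esub>\<close> (indices mod \<open>N\<close>, multiple \<open>s^(-k)\<close>, and a further factor \<open>a\<close> once \<open>i + k\<close> passes \<open>N\<close>)
  carries \<open>E\<close> to \<open>s E\<close> and \<open>F\<close> to \<open>s^(-1) F\<close>.  The R-matrix contains \<open>E\<close> and \<open>F\<close> only in the
  combinations \<open>E^l \<otimes> F^l\<close>, from which \<open>s\<close> cancels, and its diagonal factor depends only on the weights
  mod \<open>2N\<close>: since \<open>N\<close> is odd all weights are even, so \<open>q^(h h'/2)\<close> does not change when \<open>h\<close> or \<open>h'\<close> changes by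
  \<open>2N\<close>.  So \<open>G\<close> intertwines all elementary pieces, and \<open>T G = G T\<^sub>b\<close> (the locale
  \<open>scaled_iso\<close> and \<open>scaled_iso_shift\<close>).  The element \<open>K\<close> is the special case of such a map from
  \<open>\<rho>\<^sub>b\<close> to itself; its eigenvalues are distinct, so \<open>T\<^sub>b\<close> is diagonal.
  Consequently the \<open>k\<close>-th diagonal entry of \<open>T\<^sub>b\<close> is the diagonal entry of \<open>T\<close> at \<open>i + k\<close>, for every \<open>b \<noteq> 0\<close>.

  Passage to \<open>b = 0\<close>.  Every entry of \<open>T\<^sub>b\<close> is continuous in \<open>b\<close>: this is clear for the positive crossing,
  and the determinant of the crossing never vanishes, so Cramer's rule gives it for the negative
  crossing.  The diagonal entries are constant for \<open>b \<noteq> 0\<close>, so they have the same value at \<open>b = 0\<close>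
  (\<open>semicyclic_diagram_op_parameter_limit\<close>).

  Removal of the shift.  This identifies \<open>T\<close> with the operator \<open>T\<^sub>0\<close> of the standard representation up to the
  cyclic permutation \<open>k \<mapsto> i + k\<close> of the diagonal.  But \<open>T\<^sub>0\<close> commutes with \<open>E\<close>
  (\<open>standard_diagram_op_commutes_E\<close>), because cups, caps and crossings do when \<open>E\<close> acts on tensor
  products through the coproduct \<open>E \<otimes> K + 1 \<otimes> E\<close>; and \<open>E\<close> maps \<open>v\<^sub>k\<close> to \<open>v\<^bsub>k+1\<^esub>\<close>, so \<open>T\<^sub>0\<close>
  is scalar and the permutation has no effect.\<close>

section \<open>The Kronecker product\<close>

lemma mult_mat_entry:
  assumes "A \<in> carrier_mat n m" "B \<in> carrier_mat m k" "r < n" "c < k"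
  shows "(A * B) $$ (r, c) = (\<Sum>l<m. A $$ (r, l) * B $$ (l, c))"
  using assms by (auto simp: scalar_prod_def lessThan_atLeast0 intro!: sum.cong)

lemma pair_index_less:
  fixes j k :: nat
  assumes "j < m" "k < n"
  shows "j * n + k < m * n"
proof -
  have "j * n + k < Suc j * n" using assms by simp
  also have "\<dots> \<le> m * n" using assms by (intro mult_right_mono) auto
  finally show ?thesis .
qed

lemma pair_index_bounds:
  fixes r :: nat
  assumes "r < m * n"
  shows "r div n < m" "r mod n < n"
  using assms by (auto simp: less_mult_imp_div_less intro: Suc_leI)
    (metis gr0I mod_less_divisor mult_0_right not_less0)

lemma sum_pair_index:
  fixes f :: "nat \<Rightarrow> nat \<Rightarrow> 'a::comm_monoid_add"
  shows "(\<Sum>x<m * n. f (x div n) (x mod n)) = (\<Sum>j<m. \<Sum>k<n. f j k)"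
proof -
  have "(\<Sum>x<m * n. f (x div n) (x mod n)) = (\<Sum>(j, k)\<in>{..<m} \<times> {..<n}. f j k)"
    by (rule sum.reindex_bij_witness[of _ "\<lambda>(j, k). j * n + k" "\<lambda>x. (x div n, x mod n)"])
      (auto simp: pair_index_less pair_index_bounds)
  then show ?thesis by (simp add: sum.cartesian_product)
qed

lemma dim_kron [simp]:
  "dim_row (kron A B) = dim_row A * dim_row B" "dim_col (kron A B) = dim_col A * dim_col B"
  by (simp_all add: kron_def)

lemma kron_carrier [intro, simp]:
  assumes "A \<in> carrier_mat a b" "B \<in> carrier_mat c d"
  shows "kron A B \<in> carrier_mat (a * c) (b * d)"
  using assms by auto

lemma kron_entry:
  assumes "A \<in> carrier_mat a b" "B \<in> carrier_mat c d" "r < a * c" "s < b * d"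
  shows "kron A B $$ (r, s) = A $$ (r div c, s div d) * B $$ (r mod c, s mod d)"
  using assms by (auto simp: kron_def)

lemma kron_mult:
  assumes A: "A \<in> carrier_mat a b" and C: "C \<in> carrier_mat b e"
    and B: "B \<in> carrier_mat c d" and D: "D \<in> carrier_mat d f"
  shows "kron A B * kron C D = kron (A * C) (B * D)"
proof (rule eq_matI)
  show "dim_row (kron A B * kron C D) = dim_row (kron (A * C) (B * D))"
    "dim_col (kron A B * kron C D) = dim_col (kron (A * C) (B * D))" using assms by auto
  fix r s assume "r < dim_row (kron (A * C) (B * D))" "s < dim_col (kron (A * C) (B * D))"
  then have r: "r < a * c" and s: "s < e * f" using assms by auto
  have AB: "kron A B \<in> carrier_mat (a * c) (b * d)" and CD: "kron C D \<in> carrier_mat (b * d) (e * f)"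
    using assms by auto
  have "(kron A B * kron C D) $$ (r, s)
      = (\<Sum>x<b * d. A $$ (r div c, x div d) * B $$ (r mod c, x mod d)
          * (C $$ (x div d, s div f) * D $$ (x mod d, s mod f)))"
    unfolding mult_mat_entry[OF AB CD r s]
    by (rule sum.cong) (use r s kron_entry[OF A B] kron_entry[OF C D] in auto)
  also have "\<dots> = (\<Sum>j<b. \<Sum>k<d. A $$ (r div c, j) * B $$ (r mod c, k)
          * (C $$ (j, s div f) * D $$ (k, s mod f)))"
    by (rule sum_pair_index)
  also have "\<dots> = (A * C) $$ (r div c, s div f) * (B * D) $$ (r mod c, s mod f)"
    using mult_mat_entry[OF A C] mult_mat_entry[OF B D]
      pair_index_bounds[OF r] pair_index_bounds[OF s]
    by (simp add: sum_product mult_ac)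
  also have "\<dots> = kron (A * C) (B * D) $$ (r, s)"
    using kron_entry[of "A * C" a e "B * D" c f r s] assms r s by auto
  finally show "(kron A B * kron C D) $$ (r, s) = kron (A * C) (B * D) $$ (r, s)" .
qed

lemma kron_assoc: "kron (kron A B) C = kron A (kron B C)"
proof (rule eq_matI)
  fix r s assume "r < dim_row (kron A (kron B C))" "s < dim_col (kron A (kron B C))"
  then have r: "r < dim_row A * (dim_row B * dim_row C)"
    and s: "s < dim_col A * (dim_col B * dim_col C)" by auto
  note br = pair_index_bounds[OF r] and bs = pair_index_bounds[OF s]
  note cr = pair_index_bounds[of r "dim_row A * dim_row B" "dim_row C"]
  note cs = pair_index_bounds[of s "dim_col A * dim_col B" "dim_col C"]
  have *: "x mod (m * n) div n = x div n mod m" "x mod (m * n) mod n = x mod n"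
    "x div n div m = x div (m * n)" for x m n :: nat
    by (cases "n = 0"; simp add: mult.commute[of m n] mod_mult2_eq div_mult2_eq)+
  show "kron (kron A B) C $$ (r, s) = kron A (kron B C) $$ (r, s)"
    using r s br bs cr cs by (simp add: kron_def * mult.assoc)
qed auto

lemma kron_one: "kron (1\<^sub>m m) (1\<^sub>m n) = 1\<^sub>m (m * n)"
proof (rule eq_matI)
  fix r s assume "r < dim_row (1\<^sub>m (m * n) :: complex mat)" "s < dim_col (1\<^sub>m (m * n) :: complex mat)"
  then have r: "r < m * n" and s: "s < m * n" by auto
  have "r = s \<longleftrightarrow> r div n = s div n \<and> r mod n = s mod n" by (metis div_mult_mod_eq)
  then show "kron (1\<^sub>m m) (1\<^sub>m n) $$ (r, s) = 1\<^sub>m (m * n) $$ (r, s)"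
    using r s pair_index_bounds[OF r] pair_index_bounds[OF s] by (auto simp: kron_def)
qed auto

lemma kron_one_left: "kron (1\<^sub>m 1) A = A"
  by (rule eq_matI) (auto simp: kron_def)

lemma kron_one_right: "kron A (1\<^sub>m (Suc 0)) = A"
  by (rule eq_matI) (auto simp: kron_def)

lemma kron_add_left:
  assumes "A \<in> carrier_mat a b" "B \<in> carrier_mat a b" "C \<in> carrier_mat c d"
  shows "kron (A + B) C = kron A C + kron B C"
  by (rule eq_matI) (use assms in \<open>auto simp: kron_def pair_index_bounds algebra_simps\<close>)

lemma kron_add_right:
  assumes "A \<in> carrier_mat a b" "B \<in> carrier_mat a b" "C \<in> carrier_mat c d"
  shows "kron C (A + B) = kron C A + kron C B"
  by (rule eq_matI) (use assms in \<open>auto simp: kron_def pair_index_bounds algebra_simps\<close>)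

lemma kron_smult:
  "kron (x \<cdot>\<^sub>m A) B = x \<cdot>\<^sub>m kron A B" "kron A (x \<cdot>\<^sub>m B) = x \<cdot>\<^sub>m kron A B"
  by (rule eq_matI; auto simp: kron_def pair_index_bounds)+

section \<open>Quantum integers at the root of unity\<close>

lemma q_root_nonzero [simp]: "q_root N \<noteq> 0"
  by (simp add: q_root_def)

lemma q_root_powr_of_int: "q_root N powr of_int n = q_root N powi n"
  by (simp only: powr_of_int[OF q_root_nonzero] power_int_def power_inverse)

lemma q_root_powi_eq_1_iff:
  assumes "N > 0"
  shows "q_root N powi m = 1 \<longleftrightarrow> 2 * int N dvd m"
proof -
  have "q_root N powi m = exp (of_int m * (complex_of_real pi * \<i> / of_nat N))"
    by (simp add: q_root_def exp_power_int)
  then have "q_root N powi m = 1 \<longleftrightarrow> (\<exists>n::int. real_of_int m * pi / real N = of_int (2 * n) * pi)"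
    by (simp add: exp_eq_1)
  also have "\<dots> \<longleftrightarrow> (\<exists>n::int. real_of_int m = real_of_int (2 * int N * n))"
    using assms by (simp add: field_simps)
  also have "\<dots> \<longleftrightarrow> 2 * int N dvd m" unfolding of_int_eq_iff by (auto simp: dvd_def)
  finally show ?thesis .
qed

lemma q_root_powi_cong:
  assumes "N > 0" "2 * int N dvd m - m'"
  shows "q_root N powi m = q_root N powi m'"
proof -
  have "q_root N powi m = q_root N powi (m' + (m - m'))" by simp
  also have "\<dots> = q_root N powi m' * q_root N powi (m - m')"
    by (rule power_int_add) simp
  also have "q_root N powi (m - m') = 1" using assms by (simp add: q_root_powi_eq_1_iff)
  finally show ?thesis by simp
qed

lemma q_root_powi_N:
  assumes "N > 0"
  shows "q_root N powi int N = - 1"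
  using assms by (simp add: q_root_def exp_of_nat_mult[symmetric] mult.commute)

lemma q_root_minus_inverse_nonzero:
  assumes "N \<ge> 2"
  shows "q_root N - inverse (q_root N) \<noteq> 0"
proof
  assume "q_root N - inverse (q_root N) = 0"
  then have "q_root N powi 2 = 1"
    by (simp add: power2_eq_square field_simps)
  then have "2 * int N dvd 2" using assms by (subst (asm) q_root_powi_eq_1_iff) auto
  then show False using zdvd_imp_le[of "2 * int N" 2] assms by simp
qed

lemma qint_nonzero:
  assumes "0 < l" "l < N"
  shows "qint N l \<noteq> 0"
proof
  assume "qint N l = 0"
  then have eq: "q_root N powi int l = q_root N powi (- int l)"
    using q_root_minus_inverse_nonzero[of N] assms by (simp add: qint_def)
  have add: "q_root N powi (m + m') = q_root N powi m * q_root N powi m'" for m m'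
    by (rule power_int_add) simp
  have "q_root N powi (int l + int l) = 1"
    using add[of "int l" "int l"] add[of "int l" "- int l"] unfolding eq by simp
  then have "2 * int N dvd int l + int l" using assms by (subst (asm) q_root_powi_eq_1_iff) auto
  then show False using zdvd_imp_le[of "2 * int N" "int l + int l"] assms by simp
qed

lemma qint_zero [simp]: "qint N 0 = 0"
  by (simp add: qint_def)

lemma qint_complement:
  assumes "k \<le> N" "N > 0"
  shows "qint N (N - k) = qint N k"
proof -
  have "q_root N powi int (N - k) = q_root N powi int N * q_root N powi (- int k)"
    "q_root N powi (- int (N - k)) = q_root N powi int k * inverse (q_root N powi int N)"
    using assms by (simp_all add: of_nat_diff power_int_diff power_int_minus field_simps)
  then show ?thesis unfolding qint_def q_root_powi_N[OF assms(2)] by simp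
qed

lemma qfact_nonzero:
  assumes "l < N"
  shows "qfact N l \<noteq> 0"
  using assms by (induction l) (auto simp: qint_nonzero)

text \<open>The coefficient of \<open>E^l \<otimes> F^l\<close> in the R-matrix, a truncated q-exponential.\<close>

definition R_coeff :: "nat \<Rightarrow> nat \<Rightarrow> complex" where
  "R_coeff N l = (q_root N - inverse (q_root N)) ^ l / qfact N l * q_root N ^ (l * (l - 1) div 2)"

lemma R_coeff_0 [simp]: "R_coeff N 0 = 1"
  by (simp add: R_coeff_def)

text \<open>The recursion that makes the R-matrix commute with \<open>E\<close>: it cancels the factor \<open>[l + 1]\<close> that the
  commutator of \<open>E\<close> and \<open>F^(l+1)\<close> produces.\<close>

lemma R_coeff_Suc:
  assumes "Suc l < N"
  shows "R_coeff N (Suc l) * qint N (Suc l)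
    = (q_root N - inverse (q_root N)) * q_root N ^ l * R_coeff N l"
proof -
  have "Suc l * (Suc l - 1) div 2 = l + l * (l - 1) div 2"
    by (cases l) (auto simp: algebra_simps)
  then show ?thesis
    using qint_nonzero[of "Suc l" N] qfact_nonzero[of l N] assms
    by (simp add: R_coeff_def power_add field_simps)
qed

section \<open>Matrices of crossings, cups and caps\<close>

definition diag_op :: "nat \<Rightarrow> (nat \<Rightarrow> complex) \<Rightarrow> complex mat" where
  "diag_op n f = Matrix.mat n n (\<lambda>(r, c). if r = c then f c else 0)"

lemma diag_op_carrier [simp]: "diag_op n f \<in> carrier_mat n n"
  by (simp add: diag_op_def)

lemma diag_op_entry [simp]: "r < n \<Longrightarrow> c < n \<Longrightarrow> diag_op n f $$ (r, c) = (if r = c then f c else 0)"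
  by (simp add: diag_op_def)

lemma diag_op_mult_entry:
  assumes "A \<in> carrier_mat n m" "r < n" "c < m"
  shows "(diag_op n f * A) $$ (r, c) = f r * A $$ (r, c)"
proof -
  have "(diag_op n f * A) $$ (r, c) = (\<Sum>l<n. if r = l then f l * A $$ (l, c) else 0)"
    unfolding mult_mat_entry[OF diag_op_carrier assms] by (rule sum.cong) (use assms in auto)
  then show ?thesis using assms by simp
qed

lemma mult_diag_op_entry:
  assumes "A \<in> carrier_mat n m" "r < n" "c < m"
  shows "(A * diag_op m f) $$ (r, c) = A $$ (r, c) * f c"
proof -
  have "(A * diag_op m f) $$ (r, c) = (\<Sum>l<m. if c = l then A $$ (r, l) * f l else 0)"
    unfolding mult_mat_entry[OF assms(1) diag_op_carrier assms(2,3)]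
    by (rule sum.cong) (use assms in auto)
  then show ?thesis using assms by simp
qed

lemma diag_op_mult: "diag_op n f * diag_op n g = diag_op n (\<lambda>k. f k * g k)"
proof (rule eq_matI)
  fix r c assume "r < dim_row (diag_op n (\<lambda>k. f k * g k))" "c < dim_col (diag_op n (\<lambda>k. f k * g k))"
  then show "(diag_op n f * diag_op n g) $$ (r, c) = diag_op n (\<lambda>k. f k * g k) $$ (r, c)"
    using diag_op_mult_entry[OF diag_op_carrier, of r n c f g] by (simp add: diag_op_def)
qed (simp_all add: diag_op_def)

lemma diag_op_one: "diag_op n (\<lambda>_. 1) = 1\<^sub>m n"
  by (rule eq_matI) (auto simp: diag_op_def)

lemma transpose_diag_op [simp]: "transpose_mat (diag_op n f) = diag_op n f"
  by (rule eq_matI) (auto simp: diag_op_def)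

lemma flip_mat_carrier [simp]: "flip_mat N \<in> carrier_mat (N * N) (N * N)"
  by (simp add: flip_mat_def)

abbreviation swap_index :: "nat \<Rightarrow> nat \<Rightarrow> nat" where
  "swap_index N r \<equiv> r mod N * N + r div N"

lemma swap_index:
  assumes "r < N * N"
  shows "swap_index N r < N * N" "swap_index N r div N = r mod N" "swap_index N r mod N = r div N"
    "swap_index N (swap_index N r) = r"
  using pair_index_bounds[OF assms] pair_index_less[of "r mod N" N "r div N" N] by auto

lemma flip_mult_entry:
  assumes "A \<in> carrier_mat (N * N) m" "r < N * N" "c < m"
  shows "(flip_mat N * A) $$ (r, c) = A $$ (swap_index N r, c)"
proof -
  have "r = swap_index N l \<longleftrightarrow> l = swap_index N r" if "l < N * N" for l
    using swap_index[OF that] swap_index[OF assms(2)] by metis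
  then have "(flip_mat N * A) $$ (r, c)
      = (\<Sum>l<N * N. if l = swap_index N r then A $$ (l, c) else 0)"
    unfolding mult_mat_entry[OF flip_mat_carrier assms]
    by (intro sum.cong) (use assms in \<open>auto simp: flip_mat_def\<close>)
  then show ?thesis using swap_index[OF assms(2)] by simp
qed

lemma mult_flip_entry:
  assumes "A \<in> carrier_mat m (N * N)" "r < m" "c < N * N"
  shows "(A * flip_mat N) $$ (r, c) = A $$ (r, swap_index N c)"
proof -
  have "(A * flip_mat N) $$ (r, c)
      = (\<Sum>l<N * N. if l = swap_index N c then A $$ (r, l) else 0)"
    unfolding mult_mat_entry[OF assms(1) flip_mat_carrier assms(2,3)]
    by (intro sum.cong) (use assms in \<open>auto simp: flip_mat_def\<close>)
  then show ?thesis using swap_index[OF assms(3)] by simp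
qed

lemma flip_kron:
  assumes "A \<in> carrier_mat N N" "B \<in> carrier_mat N N"
  shows "flip_mat N * kron A B = kron B A * flip_mat N"
proof (rule eq_matI)
  fix r c assume "r < dim_row (kron B A * flip_mat N)" "c < dim_col (kron B A * flip_mat N)"
  then have r: "r < N * N" and c: "c < N * N" using assms by (auto simp: flip_mat_def)
  have k: "kron A B \<in> carrier_mat (N * N) (N * N)" "kron B A \<in> carrier_mat (N * N) (N * N)"
    using assms by auto
  show "(flip_mat N * kron A B) $$ (r, c) = (kron B A * flip_mat N) $$ (r, c)"
    using flip_mult_entry[OF k(1) r c] mult_flip_entry[OF k(2) r c] swap_index[OF r] swap_index[OF c]
      kron_entry[OF assms _ c] kron_entry[OF assms(2,1) r] r c
    by (metis mult.commute)
qed (use assms in \<open>auto simp: flip_mat_def\<close>)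

text \<open>A vector of \<open>V \<otimes> V\<close>, or a functional on it, is recorded by the square matrix \<open>W\<close> of its coordinates; a
  Kronecker product then acts by multiplying \<open>W\<close> from both sides, so that the compatibility of cups
  and caps with an operator becomes an identity between \<open>N \<times> N\<close> matrices.\<close>

definition cup_vec :: "nat \<Rightarrow> complex mat \<Rightarrow> complex mat" where
  "cup_vec N W = Matrix.mat (N * N) 1 (\<lambda>(r, c). W $$ (r div N, r mod N))"

definition cap_row :: "nat \<Rightarrow> complex mat \<Rightarrow> complex mat" where
  "cap_row N W = Matrix.mat 1 (N * N) (\<lambda>(r, c). W $$ (c div N, c mod N))"

lemma cup_vec_carrier [simp]: "cup_vec N W \<in> carrier_mat (N * N) 1"
  by (simp add: cup_vec_def)

lemma cap_row_carrier [simp]: "cap_row N W \<in> carrier_mat 1 (N * N)"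
  by (simp add: cap_row_def)

lemma kron_mult_cup_vec:
  assumes A: "A \<in> carrier_mat N N" and B: "B \<in> carrier_mat N N" and W: "W \<in> carrier_mat N N"
  shows "kron A B * cup_vec N W = cup_vec N (A * W * transpose_mat B)"
proof (rule eq_matI)
  fix r c assume "r < dim_row (cup_vec N (A * W * transpose_mat B))"
    "c < dim_col (cup_vec N (A * W * transpose_mat B))"
  then have r: "r < N * N" and c: "c = 0" by (auto simp: cup_vec_def)
  note br = pair_index_bounds[OF r]
  have "(kron A B * cup_vec N W) $$ (r, c) = (\<Sum>x<N * N. A $$ (r div N, x div N)
      * B $$ (r mod N, x mod N) * W $$ (x div N, x mod N))"
    unfolding c using r kron_entry[OF A B r]
    by (subst mult_mat_entry[OF kron_carrier[OF A B] cup_vec_carrier])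
      (auto simp: cup_vec_def intro!: sum.cong)
  also have "\<dots> = (\<Sum>j<N. \<Sum>k<N. A $$ (r div N, j) * B $$ (r mod N, k) * W $$ (j, k))"
    by (rule sum_pair_index)
  also have "\<dots> = (\<Sum>k<N. (\<Sum>j<N. A $$ (r div N, j) * W $$ (j, k)) * B $$ (r mod N, k))"
    by (subst sum.swap) (simp add: sum_distrib_left sum_distrib_right mult_ac)
  also have "\<dots> = (A * W * transpose_mat B) $$ (r div N, r mod N)"
    using br A B W mult_mat_entry[OF A W br(1)]
    by (subst mult_mat_entry[of "A * W" N N "transpose_mat B" N]) (auto intro!: sum.cong)
  finally show "(kron A B * cup_vec N W) $$ (r, c) = cup_vec N (A * W * transpose_mat B) $$ (r, c)"
    using r c by (simp add: cup_vec_def)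
qed (use assms in \<open>auto simp: cup_vec_def\<close>)

lemma cap_row_mult_kron:
  assumes A: "A \<in> carrier_mat N N" and B: "B \<in> carrier_mat N N" and W: "W \<in> carrier_mat N N"
  shows "cap_row N W * kron A B = cap_row N (transpose_mat A * W * B)"
proof -
  have tr: "transpose_mat (cap_row N X) = cup_vec N X" "transpose_mat (cup_vec N X) = cap_row N X" for X
    by (rule eq_matI; auto simp: cap_row_def cup_vec_def)+
  have tk: "transpose_mat (kron A B) = kron (transpose_mat A) (transpose_mat B)"
    by (rule eq_matI) (use A B in \<open>auto simp: kron_def pair_index_bounds\<close>)
  have "cap_row N W * kron A B = transpose_mat (kron (transpose_mat A) (transpose_mat B) * cup_vec N W)"
    by (subst transpose_mult[OF _ cup_vec_carrier]) (use A B in \<open>auto simp: tr tk[symmetric]\<close>)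
  also have "\<dots> = cap_row N (transpose_mat A * W * B)"
    using A B W by (simp add: kron_mult_cup_vec[of _ N] tr)
  finally show ?thesis .
qed

definition K_op :: "nat \<Rightarrow> uq_rep \<Rightarrow> complex mat" where
  "K_op N \<rho> = diag_op N (\<lambda>k. q_root N powi rep_wt \<rho> k)"

definition K_inv_op :: "nat \<Rightarrow> uq_rep \<Rightarrow> complex mat" where
  "K_inv_op N \<rho> = diag_op N (\<lambda>k. q_root N powi (- rep_wt \<rho> k))"

lemma K_op_carrier [simp]: "K_op N \<rho> \<in> carrier_mat N N" "K_inv_op N \<rho> \<in> carrier_mat N N"
  by (simp_all add: K_op_def K_inv_op_def)

lemma transpose_K_op [simp]:
  "transpose_mat (K_op N \<rho>) = K_op N \<rho>" "transpose_mat (K_inv_op N \<rho>) = K_inv_op N \<rho>"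
  by (simp_all add: K_op_def K_inv_op_def)

lemma K_op_inverse: "K_op N \<rho> * K_inv_op N \<rho> = 1\<^sub>m N" "K_inv_op N \<rho> * K_op N \<rho> = 1\<^sub>m N"
  by (simp_all add: K_op_def K_inv_op_def diag_op_mult power_int_minus diag_op_one)

lemma piece_op_cups_caps:
  "piece_op N \<rho> CupLR = cup_vec N (1\<^sub>m N)"
  "piece_op N \<rho> CupRL = cup_vec N (K_inv_op N \<rho>)"
  "piece_op N \<rho> CapLR = cap_row N (1\<^sub>m N)"
  "piece_op N \<rho> CapRL = cap_row N (K_op N \<rho>)"
  by (rule eq_matI; auto simp: cup_vec_def cap_row_def K_op_def K_inv_op_def diag_op_def
      pair_index_bounds)+

lemma mat_inverse_of_det_nonzero:
  fixes A :: "complex mat"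
  assumes "A \<in> carrier_mat n n" "det A \<noteq> 0"
  shows "A * the (mat_inverse A) = 1\<^sub>m n" "the (mat_inverse A) * A = 1\<^sub>m n"
    "the (mat_inverse A) \<in> carrier_mat n n"
proof -
  obtain B where "mat_inverse A = Some B"
    using mat_inverse(1)[OF assms(1), of "()"] det_non_zero_imp_unit[OF assms, of "()"] by (cases "mat_inverse A") auto
  then show "A * the (mat_inverse A) = 1\<^sub>m n" "the (mat_inverse A) * A = 1\<^sub>m n"
    "the (mat_inverse A) \<in> carrier_mat n n"
    using mat_inverse(2)[OF assms(1)] by auto
qed

lemma quasi_R_carrier [simp]: "quasi_R N \<rho> \<in> carrier_mat (N * N) (N * N)"
  by (simp add: quasi_R_def)

lemma R_check_carrier [simp]: "R_check N \<rho> \<in> carrier_mat (N * N) (N * N)"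
  unfolding R_check_def R_matrix_def
  by (rule mult_carrier_mat[OF flip_mat_carrier mult_carrier_mat[OF _ quasi_R_carrier]])
    (simp add: q_HH_half_def)

abbreviation HH_phase :: "nat \<Rightarrow> uq_rep \<Rightarrow> nat \<Rightarrow> nat \<Rightarrow> complex" where
  "HH_phase N \<rho> j k \<equiv> q_root N powr (of_int (rep_wt \<rho> j * rep_wt \<rho> k) / 2)"

lemma q_HH_half_diag: "q_HH_half N \<rho> = diag_op (N * N) (\<lambda>r. HH_phase N \<rho> (r div N) (r mod N))"
  unfolding q_HH_half_def diag_op_def ..

lemma quasi_R_entry:
  assumes "r < N * N" "c < N * N"
  shows "quasi_R N \<rho> $$ (r, c)
    = (\<Sum>l<N. R_coeff N l * kron (rep_E \<rho> ^\<^sub>m l) (rep_F \<rho> ^\<^sub>m l) $$ (r, c))"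
  using assms by (simp add: quasi_R_def R_coeff_def)

lemma R_check_entry:
  assumes "r < N * N" "c < N * N"
  shows "R_check N \<rho> $$ (r, c)
    = HH_phase N \<rho> (r mod N) (r div N) * quasi_R N \<rho> $$ (swap_index N r, c)"
proof -
  let ?D = "diag_op (N * N) (\<lambda>r. HH_phase N \<rho> (r div N) (r mod N))"
  have "?D * quasi_R N \<rho> \<in> carrier_mat (N * N) (N * N)"
    by (rule mult_carrier_mat[OF diag_op_carrier quasi_R_carrier])
  from flip_mult_entry[OF this assms]
  have "R_check N \<rho> $$ (r, c) = (?D * quasi_R N \<rho>) $$ (swap_index N r, c)"
    unfolding R_check_def R_matrix_def q_HH_half_diag .
  also have "\<dots> = HH_phase N \<rho> (swap_index N r div N) (swap_index N r mod N)
      * quasi_R N \<rho> $$ (swap_index N r, c)"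
    by (rule diag_op_mult_entry[OF quasi_R_carrier swap_index(1)[OF assms(1)] assms(2)])
  finally show ?thesis unfolding swap_index(2,3)[OF assms(1)] .
qed

section \<open>Operators on words of strands\<close>

fun word_op :: "(strand \<Rightarrow> complex mat) \<Rightarrow> strand list \<Rightarrow> complex mat" where
  "word_op X [] = 1\<^sub>m 1"
| "word_op X (x # s) = kron (X x) (word_op X s)"

lemma word_op_carrier [intro, simp]:
  assumes "\<And>x. X x \<in> carrier_mat N N"
  shows "word_op X s \<in> carrier_mat (N ^ length s) (N ^ length s)"
  by (induction s) (auto intro: assms simp del: carrier_matI)

lemma word_op_append: "word_op X (s @ t) = kron (word_op X s) (word_op X t)"
  by (induction s) (simp_all add: kron_one_left[simplified] kron_assoc)

lemma diagram_op_carrier: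
  assumes "tangle_diagram s D t"
    and "\<And>x. slice_op N \<rho> x \<in> carrier_mat (N ^ length (slice_top x)) (N ^ length (slice_bottom x))"
  shows "diagram_op N \<rho> s D \<in> carrier_mat (N ^ length t) (N ^ length s)"
  using assms(1)
proof (induction D arbitrary: s)
  case (Cons x D)
  then show ?case using mult_carrier_mat[OF Cons.IH assms(2)[of x]] by auto
qed auto

text \<open>The family \<open>W\<close> is arbitrary, because it is used both for maps that act on every strand
  separately and for \<open>E\<close>, whose action on a word is a sum over the strands.\<close>

lemma diagram_op_intertwines:
  assumes D: "tangle_diagram s D t"
    and W: "\<And>s. W s \<in> carrier_mat (N ^ length s) (N ^ length s)"
    and S: "\<And>x. slice_op N \<rho> x \<in> carrier_mat (N ^ length (slice_top x)) (N ^ length (slice_bottom x))"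
    and S': "\<And>x. slice_op N \<rho>' x \<in> carrier_mat (N ^ length (slice_top x)) (N ^ length (slice_bottom x))"
    and comm: "\<And>x. slice_op N \<rho>' x * W (slice_bottom x) = W (slice_top x) * slice_op N \<rho> x"
  shows "diagram_op N \<rho>' s D * W s = W t * diagram_op N \<rho> s D"
  using D
proof (induction D arbitrary: s)
  case Nil
  then show ?case using W[of t] by auto
next
  case (Cons x D)
  let ?s = "slice_top x"
  have s: "s = slice_bottom x" and D: "tangle_diagram ?s D t" using Cons.prems by auto
  note car = S[of x] S'[of x] W[of s] W[of ?s] W[of t] diagram_op_carrier[OF D S]
    diagram_op_carrier[OF D S']
  have "diagram_op N \<rho>' s (x # D) * W s
      = diagram_op N \<rho>' ?s D * (slice_op N \<rho>' x * W s)"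
    using car by (simp add: s assoc_mult_mat[OF _ _ W])
  also have "\<dots> = (diagram_op N \<rho>' ?s D * W ?s) * slice_op N \<rho> x"
    unfolding s comm by (rule assoc_mult_mat[symmetric]) (use car in auto)
  also have "\<dots> = W t * diagram_op N \<rho> s (x # D)"
    unfolding Cons.IH[OF D] using car by (simp add: assoc_mult_mat[OF W _ S])
  finally show ?case .
qed

text \<open>The vertical strands of a slice carry identity operators, so by the mixed product rule only the
  elementary piece matters.\<close>

lemma slice_op_word_op:
  assumes X: "\<And>x. X x \<in> carrier_mat N N"
    and P: "P \<in> carrier_mat (N ^ length (piece_top p)) (N ^ length (piece_bottom p))"
    and P': "P' \<in> carrier_mat (N ^ length (piece_top p)) (N ^ length (piece_bottom p))"
    and comm: "P' * word_op X (piece_bottom p) = word_op X (piece_top p) * P"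
  shows "kron (1\<^sub>m (N ^ length ls)) (kron P' (1\<^sub>m (N ^ length rs))) * word_op X (ls @ piece_bottom p @ rs)
    = word_op X (ls @ piece_top p @ rs) * kron (1\<^sub>m (N ^ length ls)) (kron P (1\<^sub>m (N ^ length rs)))"
proof -
  have W: "word_op X s \<in> carrier_mat (N ^ length s) (N ^ length s)" for s
    by (rule word_op_carrier) (rule X)
  have *: "kron (1\<^sub>m (N ^ length ls)) (kron Q (1\<^sub>m (N ^ length rs))) * word_op X (ls @ piece_bottom p @ rs)
      = kron (word_op X ls) (kron (Q * word_op X (piece_bottom p)) (word_op X rs))"
    "word_op X (ls @ piece_top p @ rs) * kron (1\<^sub>m (N ^ length ls)) (kron Q (1\<^sub>m (N ^ length rs)))
      = kron (word_op X ls) (kron (word_op X (piece_top p) * Q) (word_op X rs))"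
    if Q: "Q \<in> carrier_mat (N ^ length (piece_top p)) (N ^ length (piece_bottom p))" for Q
    unfolding word_op_append
    using W[of ls] W[of rs]
    by (simp_all add: kron_mult[OF one_carrier_mat W kron_carrier[OF Q one_carrier_mat] kron_carrier[OF W W]]
       kron_mult[OF Q W one_carrier_mat W] kron_mult[OF W one_carrier_mat kron_carrier[OF W W]
         kron_carrier[OF Q one_carrier_mat]] kron_mult[OF W Q W one_carrier_mat])
  show ?thesis unfolding *(1)[OF P'] *(2)[OF P] comm ..
qed

lemma piece_op_carrier:
  assumes "det (R_check N \<rho>) \<noteq> 0"
  shows "piece_op N \<rho> p \<in> carrier_mat (N ^ length (piece_top p)) (N ^ length (piece_bottom p))"
  using mat_inverse_of_det_nonzero(3)[OF R_check_carrier assms] R_check_carrier[of N \<rho>]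
  by (cases p) auto

lemma slice_op_carrier:
  assumes "det (R_check N \<rho>) \<noteq> 0"
  shows "slice_op N \<rho> x \<in> carrier_mat (N ^ length (slice_top x)) (N ^ length (slice_bottom x))"
proof -
  obtain ls p rs where x: "x = (ls, p, rs)" by (cases x) auto
  show ?thesis unfolding x
    using kron_carrier[OF one_carrier_mat kron_carrier[OF piece_op_carrier[OF assms, of p]
        one_carrier_mat], of "N ^ length ls" "N ^ length rs"]
    by (simp add: power_add)
qed

section \<open>Isomorphisms of representations up to a rescaling of E and F\<close>

definition strand_op :: "complex mat \<Rightarrow> complex mat \<Rightarrow> strand \<Rightarrow> complex mat" where
  "strand_op A B x = (case x of Down \<Rightarrow> A | Up \<Rightarrow> B)"

lemma strand_op_simps [simp]: "strand_op A B Down = A" "strand_op A B Up = B"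
  by (simp_all add: strand_op_def)

text \<open>\<open>G\<close> is an isomorphism of representations after replacing \<open>E\<close> by \<open>t E\<close> and \<open>F\<close> by \<open>t^(-1) F\<close>, and
  \<open>G\<^sub>d\<close> is the contragredient map on \<open>V*\<close>.  The weights are compared mod \<open>2N\<close> only, because the cyclic
  shift of the basis wraps around; evenness of the weights makes this harmless for the R-matrix.\<close>

locale scaled_iso =
  fixes N :: nat and t :: complex and \<rho> \<rho>' :: uq_rep and G G\<^sub>d :: "complex mat"
  assumes N_pos: "N > 0" and t_nonzero: "t \<noteq> 0"
    and G [simp]: "G \<in> carrier_mat N N" and Gd [simp]: "G\<^sub>d \<in> carrier_mat N N"
    and E [simp]: "rep_E \<rho> \<in> carrier_mat N N" and E' [simp]: "rep_E \<rho>' \<in> carrier_mat N N"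
    and F [simp]: "rep_F \<rho> \<in> carrier_mat N N" and F' [simp]: "rep_F \<rho>' \<in> carrier_mat N N"
    and dual: "transpose_mat G\<^sub>d * G = 1\<^sub>m N"
    and E_comm: "rep_E \<rho>' * G = t \<cdot>\<^sub>m (G * rep_E \<rho>)"
    and F_comm: "t \<cdot>\<^sub>m (rep_F \<rho>' * G) = G * rep_F \<rho>"
    and even_wt: "\<And>k. even (rep_wt \<rho> k)" "\<And>k. even (rep_wt \<rho>' k)"
    and wt_cong: "\<And>r c. r < N \<Longrightarrow> c < N \<Longrightarrow> G $$ (r, c) \<noteq> 0 \<Longrightarrow> 2 * int N dvd rep_wt \<rho>' r - rep_wt \<rho> c"
    and R_inv: "det (R_check N \<rho>) \<noteq> 0"
begin

lemma Gdt [simp]: "transpose_mat G\<^sub>d \<in> carrier_mat N N"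
  and Gt: "transpose_mat G \<in> carrier_mat N N"
  by (rule iffD2[OF transpose_carrier_mat], simp)+

lemma dual': "G * transpose_mat G\<^sub>d = 1\<^sub>m N"
  using mat_mult_left_right_inverse[OF Gdt G dual] .

lemma K_comm:
  "K_op N \<rho>' * G = G * K_op N \<rho>" "K_inv_op N \<rho>' * G = G * K_inv_op N \<rho>"
proof -
  have "K_op N \<rho>' * G = G * K_op N \<rho> \<and> K_inv_op N \<rho>' * G = G * K_inv_op N \<rho>"
  proof (intro conjI; rule eq_matI)
    fix r c assume "r < dim_row (G * K_op N \<rho>)" "c < dim_col (G * K_op N \<rho>)"
    then have rc: "r < N" "c < N" using carrier_matD[OF G] by (auto simp: K_op_def diag_op_def)
    have "G $$ (r, c) = 0 \<or> q_root N powi rep_wt \<rho>' r = q_root N powi rep_wt \<rho> c"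
      using q_root_powi_cong[OF N_pos wt_cong[OF rc]] by blast
    then show "(K_op N \<rho>' * G) $$ (r, c) = (G * K_op N \<rho>) $$ (r, c)"
      unfolding K_op_def diag_op_mult_entry[OF G rc] mult_diag_op_entry[OF G rc] by auto
  next
    fix r c assume "r < dim_row (G * K_inv_op N \<rho>)" "c < dim_col (G * K_inv_op N \<rho>)"
    then have rc: "r < N" "c < N" using carrier_matD[OF G] by (auto simp: K_inv_op_def diag_op_def)
    have "G $$ (r, c) = 0 \<or> q_root N powi rep_wt \<rho>' r = q_root N powi rep_wt \<rho> c"
      using q_root_powi_cong[OF N_pos wt_cong[OF rc]] by blast
    then show "(K_inv_op N \<rho>' * G) $$ (r, c) = (G * K_inv_op N \<rho>) $$ (r, c)"
      unfolding K_inv_op_def diag_op_mult_entry[OF G rc] mult_diag_op_entry[OF G rc]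
      by (auto simp: power_int_minus)
  qed (use carrier_matD[OF G] in \<open>auto simp: K_op_def K_inv_op_def diag_op_def\<close>)
  then show "K_op N \<rho>' * G = G * K_op N \<rho>" "K_inv_op N \<rho>' * G = G * K_inv_op N \<rho>" by auto
qed

lemma conj_K_inv: "G\<^sub>d * K_inv_op N \<rho> * transpose_mat G = K_inv_op N \<rho>'"
proof -
  have "G * K_inv_op N \<rho> * transpose_mat G\<^sub>d = K_inv_op N \<rho>' * (G * transpose_mat G\<^sub>d)"
    unfolding K_comm(2)[symmetric] by (rule assoc_mult_mat[OF K_op_carrier(2) G Gdt])
  then have "K_inv_op N \<rho>' = G * K_inv_op N \<rho> * transpose_mat G\<^sub>d"
    using dual' K_op_carrier(2)[of N \<rho>'] by simp
  then have "transpose_mat (K_inv_op N \<rho>') = transpose_mat (G * K_inv_op N \<rho> * transpose_mat G\<^sub>d)"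
    by simp
  also have "\<dots> = G\<^sub>d * (K_inv_op N \<rho> * transpose_mat G)"
    unfolding transpose_mult[OF mult_carrier_mat[OF G K_op_carrier(2)] Gdt]
      transpose_mult[OF G K_op_carrier(2)] by simp
  also have "\<dots> = G\<^sub>d * K_inv_op N \<rho> * transpose_mat G"
    by (rule assoc_mult_mat[symmetric, OF Gd K_op_carrier(2) Gt])
  finally show ?thesis by simp
qed

lemma conj_K: "transpose_mat G * K_op N \<rho>' * G\<^sub>d = K_op N \<rho>"
proof -
  have "transpose_mat G\<^sub>d * (K_op N \<rho>' * G) = (transpose_mat G\<^sub>d * G) * K_op N \<rho>"
    unfolding K_comm(1) by (rule assoc_mult_mat[symmetric, OF Gdt G K_op_carrier(1)])
  then have "K_op N \<rho> = transpose_mat G\<^sub>d * (K_op N \<rho>' * G)"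
    using dual K_op_carrier(1)[of N \<rho>] by simp
  then have "transpose_mat (K_op N \<rho>) = transpose_mat (transpose_mat G\<^sub>d * (K_op N \<rho>' * G))"
    by simp
  also have "\<dots> = transpose_mat G * K_op N \<rho>' * G\<^sub>d"
    unfolding transpose_mult[OF Gdt mult_carrier_mat[OF K_op_carrier(1) G]]
      transpose_mult[OF K_op_carrier(1) G] by simp
  finally show ?thesis by simp
qed

lemma power_comm:
  "rep_E \<rho>' ^\<^sub>m l * G = t ^ l \<cdot>\<^sub>m (G * rep_E \<rho> ^\<^sub>m l)"
  "t ^ l \<cdot>\<^sub>m (rep_F \<rho>' ^\<^sub>m l * G) = G * rep_F \<rho> ^\<^sub>m l"
proof (induction l)
  case 0
  have one: "1 \<cdot>\<^sub>m A = A" for A :: "complex mat" by (rule eq_matI) auto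
  note dims = carrier_matD[OF E] carrier_matD[OF E'] carrier_matD[OF F] carrier_matD[OF F']
  { case 1 show ?case using left_mult_one_mat[OF G] right_mult_one_mat[OF G] by (simp add: one dims) }
  { case 2 show ?case using left_mult_one_mat[OF G] right_mult_one_mat[OF G] by (simp add: one dims) }
next
  case (Suc l)
  have alg: "(A * B) * C = A * (B * C)" "A * (k \<cdot>\<^sub>m B) = k \<cdot>\<^sub>m (A * B)"
    "(k \<cdot>\<^sub>m A) * B = k \<cdot>\<^sub>m (A * B)" "A * B \<in> carrier_mat N N" "k \<cdot>\<^sub>m A \<in> carrier_mat N N"
    if "A \<in> carrier_mat N N" "B \<in> carrier_mat N N" "C \<in> carrier_mat N N"
    for A B C :: "complex mat" and k
    using that assoc_mult_mat[OF that] mult_smult_distrib[OF that(1,2)]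
      mult_smult_assoc_mat[OF that(1,2)] mult_carrier_mat[OF that(1,2)] by auto
  have sm: "a \<cdot>\<^sub>m (b \<cdot>\<^sub>m A) = (a * b) \<cdot>\<^sub>m A" for a b and A :: "complex mat"
    by (rule eq_matI) auto
  note car = pow_carrier_mat[OF E, of l] pow_carrier_mat[OF E', of l] pow_carrier_mat[OF F, of l]
    pow_carrier_mat[OF F', of l] G E F E' F'
  let ?E = "rep_E \<rho>" and ?E' = "rep_E \<rho>'" and ?F = "rep_F \<rho>" and ?F' = "rep_F \<rho>'"
  { case 1
    have "?E' ^\<^sub>m Suc l * G = ?E' ^\<^sub>m l * (?E' * G)"
      unfolding pow_mat.simps by (rule alg(1)) (use car in auto)
    also have "\<dots> = t \<cdot>\<^sub>m (?E' ^\<^sub>m l * (G * ?E))"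
      unfolding E_comm by (rule alg(2)) (use car mult_carrier_mat[OF G E] in auto)
    also have "\<dots> = t \<cdot>\<^sub>m ((?E' ^\<^sub>m l * G) * ?E)"
      unfolding alg(1)[OF car(2,5,6)] ..
    also have "\<dots> = t \<cdot>\<^sub>m (t ^ l \<cdot>\<^sub>m ((G * ?E ^\<^sub>m l) * ?E))"
      unfolding Suc.IH(1) alg(3)[OF mult_carrier_mat[OF G car(1)] E E] ..
    also have "\<dots> = t ^ Suc l \<cdot>\<^sub>m (G * ?E ^\<^sub>m Suc l)"
      unfolding alg(1)[OF G car(1) E] by (simp add: sm)
    finally show ?case . }
  { case 2
    have "?F' ^\<^sub>m Suc l * G = ?F' ^\<^sub>m l * (?F' * G)"
      unfolding pow_mat.simps by (rule alg(1)) (use car in auto)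
    then have "t ^ Suc l \<cdot>\<^sub>m (?F' ^\<^sub>m Suc l * G) = t ^ l \<cdot>\<^sub>m (?F' ^\<^sub>m l * (t \<cdot>\<^sub>m (?F' * G)))"
      unfolding alg(2)[OF car(4) mult_carrier_mat[OF F' G] G] by (simp add: sm mult.commute)
    also have "\<dots> = (t ^ l \<cdot>\<^sub>m (?F' ^\<^sub>m l * G)) * ?F"
      unfolding F_comm alg(3)[OF mult_carrier_mat[OF car(4) G] F F] alg(1)[OF car(4) G F] ..
    also have "\<dots> = G * ?F ^\<^sub>m Suc l"
      unfolding Suc.IH(2) alg(1)[OF G car(3) F] by simp
    finally show ?case . }
qed

lemma GG [simp]: "kron G G \<in> carrier_mat (N * N) (N * N)"
  by (intro kron_carrier G)

text \<open>The scalars \<open>t^l\<close> and \<open>t^(-l)\<close> from the two tensor factors cancel.\<close>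

lemma quasi_R_comm: "quasi_R N \<rho>' * kron G G = kron G G * quasi_R N \<rho>"
proof (rule eq_matI)
  fix r c assume "r < dim_row (kron G G * quasi_R N \<rho>)" "c < dim_col (kron G G * quasi_R N \<rho>)"
  then have r: "r < N * N" and c: "c < N * N" using carrier_matD[OF G] by (auto simp: quasi_R_def)
  let ?T = "\<lambda>\<rho> l. kron (rep_E \<rho> ^\<^sub>m l) (rep_F \<rho> ^\<^sub>m l)"
  have T: "?T \<rho> l \<in> carrier_mat (N * N) (N * N)" "?T \<rho>' l \<in> carrier_mat (N * N) (N * N)" for l
    by (intro kron_carrier pow_carrier_mat E F E' F')+
  have comm: "?T \<rho>' l * kron G G = kron G G * ?T \<rho> l" for l
  proof -
    have "?T \<rho>' l * kron G G = kron (t ^ l \<cdot>\<^sub>m (G * rep_E \<rho> ^\<^sub>m l)) (rep_F \<rho>' ^\<^sub>m l * G)"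
      unfolding power_comm(1)[symmetric]
      by (rule kron_mult[of _ N N _ N _ N N _ N]) (auto intro: pow_carrier_mat)
    also have "\<dots> = kron (G * rep_E \<rho> ^\<^sub>m l) (G * rep_F \<rho> ^\<^sub>m l)"
      unfolding power_comm(2)[symmetric] kron_smult ..
    also have "\<dots> = kron G G * ?T \<rho> l"
      by (rule kron_mult[symmetric, of _ N N _ N _ N N _ N]) (auto intro: pow_carrier_mat)
    finally show ?thesis .
  qed
  have "(quasi_R N \<rho>' * kron G G) $$ (r, c)
      = (\<Sum>x<N * N. \<Sum>l<N. R_coeff N l * (?T \<rho>' l $$ (r, x) * kron G G $$ (x, c)))"
    unfolding mult_mat_entry[OF quasi_R_carrier GG r c]
    by (intro sum.cong) (auto simp: quasi_R_entry[OF r] sum_distrib_right sum_distrib_left mult_ac)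
  also have "\<dots> = (\<Sum>l<N. R_coeff N l * (?T \<rho>' l * kron G G) $$ (r, c))"
    unfolding mult_mat_entry[OF T(2) GG r c] by (subst sum.swap) (simp add: sum_distrib_left)
  also have "\<dots> = (\<Sum>x<N * N. \<Sum>l<N. R_coeff N l * (kron G G $$ (r, x) * ?T \<rho> l $$ (x, c)))"
    unfolding comm mult_mat_entry[OF GG T(1) r c] by (subst sum.swap) (simp add: sum_distrib_left)
  also have "\<dots> = (kron G G * quasi_R N \<rho>) $$ (r, c)"
    unfolding mult_mat_entry[OF GG quasi_R_carrier r c]
    by (intro sum.cong) (auto simp: quasi_R_entry[OF _ c] sum_distrib_left mult_ac)
  finally show "(quasi_R N \<rho>' * kron G G) $$ (r, c) = (kron G G * quasi_R N \<rho>) $$ (r, c)" .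
qed (use carrier_matD[OF G] in \<open>auto simp: quasi_R_def\<close>)

text \<open>With even weights \<open>2x\<close> and \<open>2y\<close> the phase is \<open>q^(2xy)\<close>, and changing \<open>x\<close> or \<open>y\<close> by multiples of
  \<open>N\<close> changes the exponent by a multiple of \<open>2N\<close>.\<close>

lemma HH_phase_cong:
  assumes "2 * int N dvd rep_wt \<rho>' j' - rep_wt \<rho> j" "2 * int N dvd rep_wt \<rho>' k' - rep_wt \<rho> k"
  shows "HH_phase N \<rho>' j' k' = HH_phase N \<rho> j k"
proof -
  obtain u v where u: "rep_wt \<rho>' j' = rep_wt \<rho> j + 2 * int N * u"
    and v: "rep_wt \<rho>' k' = rep_wt \<rho> k + 2 * int N * v"
    using assms by (metis add.commute diff_add_cancel dvdE)
  obtain x y where x: "rep_wt \<rho> j = 2 * x" and y: "rep_wt \<rho> k = 2 * y"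
    using even_wt(1) by (meson evenE)
  obtain x' y' where x': "rep_wt \<rho>' j' = 2 * x'" and y': "rep_wt \<rho>' k' = 2 * y'"
    using even_wt(2) by (meson evenE)
  have h: "HH_phase N \<sigma> i l = q_root N powi (2 * m * n)"
    if "rep_wt \<sigma> i = 2 * m" "rep_wt \<sigma> l = 2 * n" for \<sigma> i l m n
  proof -
    have "of_int (rep_wt \<sigma> i * rep_wt \<sigma> l) / 2 = (of_int (2 * m * n) :: complex)"
      unfolding that by simp
    then show ?thesis by (simp only: q_root_powr_of_int)
  qed
  have "x' = x + int N * u" "y' = y + int N * v" using u v x y x' y' by auto
  then have "2 * x' * y' - 2 * x * y = 2 * int N * (u * y + v * x + int N * u * v)"
    by (simp add: algebra_simps)
  then have "2 * int N dvd 2 * x' * y' - 2 * x * y" by simp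
  then show ?thesis unfolding h[OF x y] h[OF x' y'] by (rule q_root_powi_cong[OF N_pos])
qed

lemma q_HH_half_comm: "q_HH_half N \<rho>' * kron G G = kron G G * q_HH_half N \<rho>"
proof (rule eq_matI)
  fix r c assume "r < dim_row (kron G G * q_HH_half N \<rho>)" "c < dim_col (kron G G * q_HH_half N \<rho>)"
  then have r: "r < N * N" and c: "c < N * N" using carrier_matD[OF G] by (auto simp: q_HH_half_def)
  have "HH_phase N \<rho>' (r div N) (r mod N) = HH_phase N \<rho> (c div N) (c mod N)"
    if "kron G G $$ (r, c) \<noteq> 0"
    using that unfolding kron_entry[OF G G r c]
    by (intro HH_phase_cong wt_cong) (use pair_index_bounds[OF r] pair_index_bounds[OF c] in auto)
  then show "(q_HH_half N \<rho>' * kron G G) $$ (r, c) = (kron G G * q_HH_half N \<rho>) $$ (r, c)"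
    unfolding q_HH_half_diag diag_op_mult_entry[OF GG r c] mult_diag_op_entry[OF GG r c] by auto
qed (use carrier_matD[OF G] in \<open>auto simp: q_HH_half_def\<close>)

lemma R_check_comm: "R_check N \<rho>' * kron G G = kron G G * R_check N \<rho>"
proof -
  have H: "q_HH_half N \<sigma> \<in> carrier_mat (N * N) (N * N)" for \<sigma> by (simp add: q_HH_half_def)
  note car = H quasi_R_carrier flip_mat_carrier GG
  let ?n = "N * N"
  have a: "(A * B) * C = A * (B * C)"
    if "A \<in> carrier_mat ?n ?n" "B \<in> carrier_mat ?n ?n" "C \<in> carrier_mat ?n ?n" for A B C :: "complex mat"
    using that by (rule assoc_mult_mat)
  have m: "A * B \<in> carrier_mat ?n ?n" if "A \<in> carrier_mat ?n ?n" "B \<in> carrier_mat ?n ?n"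
    for A B :: "complex mat" using that by (rule mult_carrier_mat)
  have "R_check N \<rho>' * kron G G = flip_mat N * (q_HH_half N \<rho>' * (quasi_R N \<rho>' * kron G G))"
    unfolding R_check_def R_matrix_def by (simp add: a m car)
  also have "\<dots> = flip_mat N * ((q_HH_half N \<rho>' * kron G G) * quasi_R N \<rho>)"
    unfolding quasi_R_comm by (simp add: a m car)
  also have "\<dots> = (flip_mat N * kron G G) * (q_HH_half N \<rho> * quasi_R N \<rho>)"
    unfolding q_HH_half_comm by (simp add: a m car)
  also have "\<dots> = kron G G * R_check N \<rho>"
    unfolding flip_kron[OF G G] R_check_def R_matrix_def by (simp add: a m car)
  finally show ?thesis .
qed

lemma R_inv': "det (R_check N \<rho>') \<noteq> 0"
proof -
  let ?H = "kron (transpose_mat G\<^sub>d) (transpose_mat G\<^sub>d)"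
  have H: "?H \<in> carrier_mat (N * N) (N * N)" by (intro kron_carrier Gdt)
  have "?H * kron G G = 1\<^sub>m (N * N)"
    using kron_mult[OF Gdt G Gdt G] by (simp add: dual kron_one)
  then have "det ?H * det (kron G G) = 1"
    using det_mult[OF H GG] by simp
  then have "det (kron G G) \<noteq> 0" by auto
  moreover have "det (R_check N \<rho>') * det (kron G G) = det (kron G G) * det (R_check N \<rho>)"
    using R_check_comm det_mult[OF R_check_carrier GG] det_mult[OF GG R_check_carrier] by metis
  ultimately show ?thesis using R_inv by auto
qed

lemma R_check_inverse_comm:
  "the (mat_inverse (R_check N \<rho>')) * kron G G = kron G G * the (mat_inverse (R_check N \<rho>))"
proof -
  let ?A = "R_check N \<rho>" and ?A' = "R_check N \<rho>'"
  let ?B = "the (mat_inverse ?A)" and ?B' = "the (mat_inverse ?A')"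
  note i = mat_inverse_of_det_nonzero[OF R_check_carrier R_inv]
    and i' = mat_inverse_of_det_nonzero[OF R_check_carrier R_inv']
  have "?B' * kron G G = ?B' * (kron G G * (?A * ?B))"
    unfolding i(1) using right_mult_one_mat[OF GG] by simp
  also have "\<dots> = ?B' * (kron G G * ?A * ?B)"
    by (subst assoc_mult_mat[OF GG R_check_carrier i(3)]) simp
  also have "\<dots> = ?B' * (?A' * (kron G G * ?B))"
    unfolding R_check_comm[symmetric] by (subst assoc_mult_mat[OF R_check_carrier GG i(3)]) simp
  also have "\<dots> = (?B' * ?A') * (kron G G * ?B)"
    by (rule assoc_mult_mat[symmetric, OF i'(3) R_check_carrier mult_carrier_mat[OF GG i(3)]])
  also have "\<dots> = kron G G * ?B"
    unfolding i'(2) by (rule left_mult_one_mat[OF mult_carrier_mat[OF GG i(3)]])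
  finally show ?thesis .
qed

lemma piece_op_comm:
  "piece_op N \<rho>' p * word_op (strand_op G G\<^sub>d) (piece_bottom p)
    = word_op (strand_op G G\<^sub>d) (piece_top p) * piece_op N \<rho> p"
proof -
  note [simp] = kron_one_right right_mult_one_mat[OF cup_vec_carrier] left_mult_one_mat[OF cap_row_carrier]
  show ?thesis
  proof (cases p)
    case CupLR
    show ?thesis unfolding CupLR piece_op_cups_caps
      using right_mult_one_mat[OF cup_vec_carrier] left_mult_one_mat[OF Gdt] right_mult_one_mat[OF G]
      by (simp add: kron_mult_cup_vec[OF G Gd] dual')
  next
    case CupRL
    show ?thesis unfolding CupRL piece_op_cups_caps
      using right_mult_one_mat[OF cup_vec_carrier]
      by (simp add: kron_mult_cup_vec[OF Gd G] conj_K_inv)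
  next
    case CapLR
    show ?thesis unfolding CapLR piece_op_cups_caps
      using left_mult_one_mat[OF cap_row_carrier] right_mult_one_mat[OF Gdt]
      by (simp add: cap_row_mult_kron[OF Gd G] dual)
  next
    case CapRL
    show ?thesis unfolding CapRL piece_op_cups_caps
      using left_mult_one_mat[OF cap_row_carrier]
      by (simp add: cap_row_mult_kron[OF G Gd] conj_K)
  qed (simp_all add: R_check_comm R_check_inverse_comm)
qed

lemma strand_op_carrier: "strand_op G G\<^sub>d x \<in> carrier_mat N N"
  by (cases x) auto

lemma diagram_op_comm:
  assumes "tangle_diagram s D u"
  shows "diagram_op N \<rho>' s D * word_op (strand_op G G\<^sub>d) s
    = word_op (strand_op G G\<^sub>d) u * diagram_op N \<rho> s D"
proof (rule diagram_op_intertwines[OF assms])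
  fix x :: slice
  obtain ls p rs where x: "x = (ls, p, rs)" by (cases x) auto
  show "slice_op N \<rho>' x * word_op (strand_op G G\<^sub>d) (slice_bottom x)
      = word_op (strand_op G G\<^sub>d) (slice_top x) * slice_op N \<rho> x"
    unfolding x slice_op.simps slice_bottom.simps slice_top.simps
    by (intro slice_op_word_op strand_op_carrier piece_op_carrier R_inv R_inv' piece_op_comm)
qed (intro word_op_carrier strand_op_carrier slice_op_carrier R_inv R_inv')+

end

section \<open>Monomial matrices and the semicyclic representations\<close>

definition monomial_op :: "nat \<Rightarrow> (nat \<Rightarrow> nat) \<Rightarrow> (nat \<Rightarrow> complex) \<Rightarrow> complex mat" where
  "monomial_op n \<sigma> g = Matrix.mat n n (\<lambda>(r, c). if r = \<sigma> c then g c else 0)"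

lemma monomial_op_carrier [simp]: "monomial_op n \<sigma> g \<in> carrier_mat n n"
  by (simp add: monomial_op_def)

lemma monomial_op_entry [simp]:
  "r < n \<Longrightarrow> c < n \<Longrightarrow> monomial_op n \<sigma> g $$ (r, c) = (if r = \<sigma> c then g c else 0)"
  by (simp add: monomial_op_def)

lemma mult_monomial_op_entry:
  assumes "A \<in> carrier_mat m n" "r < m" "c < n" "\<sigma> c < n"
  shows "(A * monomial_op n \<sigma> g) $$ (r, c) = A $$ (r, \<sigma> c) * g c"
proof -
  have "(A * monomial_op n \<sigma> g) $$ (r, c) = (\<Sum>l<n. if l = \<sigma> c then A $$ (r, l) * g c else 0)"
    unfolding mult_mat_entry[OF assms(1) monomial_op_carrier assms(2,3)]
    by (rule sum.cong) (use assms in auto)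
  then show ?thesis using assms by simp
qed

lemma monomial_op_cong:
  assumes "\<And>c. c < n \<Longrightarrow> \<sigma> c = \<tau> c" "\<And>c. c < n \<Longrightarrow> g c = h c"
  shows "monomial_op n \<sigma> g = monomial_op n \<tau> h"
  by (rule eq_matI) (use assms in \<open>auto simp: monomial_op_def\<close>)

lemma monomial_op_mult:
  assumes "\<And>c. c < n \<Longrightarrow> \<tau> c < n"
  shows "monomial_op n \<sigma> g * monomial_op n \<tau> h = monomial_op n (\<lambda>c. \<sigma> (\<tau> c)) (\<lambda>c. g (\<tau> c) * h c)"
proof (rule eq_matI)
  fix r c assume "r < dim_row (monomial_op n (\<lambda>c. \<sigma> (\<tau> c)) (\<lambda>c. g (\<tau> c) * h c))"
    "c < dim_col (monomial_op n (\<lambda>c. \<sigma> (\<tau> c)) (\<lambda>c. g (\<tau> c) * h c))"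
  then have rc: "r < n" "c < n" by (auto simp: monomial_op_def)
  then show "(monomial_op n \<sigma> g * monomial_op n \<tau> h) $$ (r, c)
      = monomial_op n (\<lambda>c. \<sigma> (\<tau> c)) (\<lambda>c. g (\<tau> c) * h c) $$ (r, c)"
    using mult_monomial_op_entry[where \<sigma> = \<tau> and g = h, OF monomial_op_carrier[of n \<sigma> g] rc]
      assms[OF rc(2)] by simp
qed (auto simp: monomial_op_def)

lemma smult_monomial_op: "k \<cdot>\<^sub>m monomial_op n \<sigma> g = monomial_op n \<sigma> (\<lambda>c. k * g c)"
  by (rule eq_matI) (auto simp: monomial_op_def)

lemma semicyclic_E_monomial:
  assumes "N > 0"
  shows "rep_E (semicyclic_rep N a i)
    = monomial_op N (\<lambda>c. (c + 1) mod N) (\<lambda>c. if c < N - 1 then 1 else a)"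
proof (rule eq_matI)
  fix r c assume "r < dim_row (monomial_op N (\<lambda>c. (c + 1) mod N) (\<lambda>c. if c < N - 1 then 1 else a))"
    "c < dim_col (monomial_op N (\<lambda>c. (c + 1) mod N) (\<lambda>c. if c < N - 1 then 1 else a))"
  then have "r < N" "c < N" by (auto simp: monomial_op_def)
  moreover have "c = N - 1" if "\<not> c < N - 1" using that \<open>c < N\<close> by simp
  ultimately show "rep_E (semicyclic_rep N a i) $$ (r, c)
    = monomial_op N (\<lambda>c. (c + 1) mod N) (\<lambda>c. if c < N - 1 then 1 else a) $$ (r, c)"
    by (cases "c < N - 1") (auto simp: semicyclic_rep_def)
qed (auto simp: semicyclic_rep_def monomial_op_def)

definition semicyclic_F_coeff :: "nat \<Rightarrow> complex \<Rightarrow> nat \<Rightarrow> nat \<Rightarrow> complex" where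
  "semicyclic_F_coeff N a i c = (let k = (c + N - i) mod N in
     if c \<noteq> 0 then qint N k * qint N (N - k) else qint N k * qint N (N - k) / a)"

lemma semicyclic_F_monomial:
  "rep_F (semicyclic_rep N a i) = monomial_op N (\<lambda>c. (c + N - 1) mod N) (semicyclic_F_coeff N a i)"
  by (rule eq_matI) (auto simp: semicyclic_rep_def monomial_op_def semicyclic_F_coeff_def Let_def)

lemma semicyclic_F_coeff_0:
  assumes "c < N"
  shows "semicyclic_F_coeff N b 0 c = qint N c * qint N (N - c)"
  using assms by (auto simp: semicyclic_F_coeff_def)

text \<open>Without shift, \<open>F v\<^sub>0\<close> has the coefficient \<open>[0][N] / a\<close>, whose numerator vanishes; this gives
  \<open>F v\<^sub>0 = 0\<close> also when \<open>a = 0\<close>.\<close>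

lemma standard_rep_eq_semicyclic_rep:
  assumes "N > 0"
  shows "standard_rep N = semicyclic_rep N 0 0"
proof -
  have E: "rep_E (standard_rep N) = rep_E (semicyclic_rep N 0 0)"
    by (rule eq_matI) (auto simp: standard_rep_def semicyclic_rep_def)
  have F: "rep_F (standard_rep N) = rep_F (semicyclic_rep N 0 0)"
  proof (rule eq_matI)
    fix r c assume "r < dim_row (rep_F (semicyclic_rep N 0 0))" "c < dim_col (rep_F (semicyclic_rep N 0 0))"
    then have "r < N" "c < N" by (auto simp: semicyclic_rep_def)
    then show "rep_F (standard_rep N) $$ (r, c) = rep_F (semicyclic_rep N 0 0) $$ (r, c)"
      unfolding semicyclic_F_monomial
      by (cases c) (auto simp: semicyclic_F_coeff_0 standard_rep_def)
  qed (auto simp: standard_rep_def semicyclic_rep_def)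
  show ?thesis
    using E F by (simp add: standard_rep_def semicyclic_rep_def)
qed

lemma semicyclic_wt [simp]: "rep_wt (semicyclic_rep N a i) k = 1 - int N + 2 * (int k - int i)"
  by (simp add: semicyclic_rep_def)

lemma semicyclic_carrier [simp]:
  "rep_E (semicyclic_rep N a i) \<in> carrier_mat N N" "rep_F (semicyclic_rep N a i) \<in> carrier_mat N N"
  by (simp_all add: semicyclic_rep_def)

text \<open>The scalar with \<open>F^l v\<^sub>k = F_power_coeff N k l v\<^bsub>k-l\<^esub>\<close>, for every \<open>\<rho>\<^sub>b\<close>.\<close>

fun F_power_coeff :: "nat \<Rightarrow> nat \<Rightarrow> nat \<Rightarrow> complex" where
  "F_power_coeff N k 0 = 1"
| "F_power_coeff N k (Suc l) = F_power_coeff N k l * (qint N (k - l) * qint N (N - (k - l)))"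

lemma F_power_coeff_Suc:
  "F_power_coeff N (Suc k) (Suc l) = qint N (Suc k) * qint N (N - Suc k) * F_power_coeff N k l"
  by (induction l) auto

lemma semicyclic_F_power_entry:
  assumes "r < N" "c < N"
  shows "(rep_F (semicyclic_rep N b 0) ^\<^sub>m l) $$ (r, c) = (if r + l = c then F_power_coeff N c l else 0)"
  using assms
proof (induction l arbitrary: c)
  case 0
  then show ?case by (simp add: semicyclic_rep_def)
next
  case (Suc l)
  let ?F = "rep_F (semicyclic_rep N b 0)"
  have F: "?F ^\<^sub>m l \<in> carrier_mat N N" by (intro pow_carrier_mat semicyclic_carrier)
  show ?case
  proof (cases c)
    case 0
    have "(?F ^\<^sub>m Suc l) $$ (r, c) = (?F ^\<^sub>m l) $$ (r, (c + N - 1) mod N) * semicyclic_F_coeff N b 0 c"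
      unfolding pow_mat.simps unfolding semicyclic_F_monomial[of N b 0]
      by (rule mult_monomial_op_entry[OF F[unfolded semicyclic_F_monomial]]) (use Suc.prems in auto)
    then show ?thesis using 0 Suc.prems by (simp add: semicyclic_F_coeff_0)
  next
    case (Suc c')
    have "(?F ^\<^sub>m Suc l) $$ (r, c) = (?F ^\<^sub>m l) $$ (r, (c + N - 1) mod N) * semicyclic_F_coeff N b 0 c"
      unfolding pow_mat.simps unfolding semicyclic_F_monomial[of N b 0]
      by (rule mult_monomial_op_entry[OF F[unfolded semicyclic_F_monomial]]) (use Suc.prems in auto)
    moreover have "(c + N - 1) mod N = c'" using Suc Suc.prems by simp
    ultimately show ?thesis
      using Suc Suc.prems Suc.IH[of c'] semicyclic_F_coeff_0[of c N b] F_power_coeff_Suc[of N c' l]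
      by auto
  qed
qed

text \<open>Since \<open>F^l\<close> lowers the index by exactly \<open>l\<close>, the indices in the second tensor factor single out one
  summand.\<close>

lemma semicyclic_quasi_R_entry:
  assumes r: "r < N * N" and c: "c < N * N"
  shows "quasi_R N (semicyclic_rep N b 0) $$ (r, c)
    = (if r mod N \<le> c mod N then let l = c mod N - r mod N in
         R_coeff N l * (rep_E (semicyclic_rep N b 0) ^\<^sub>m l) $$ (r div N, c div N)
           * F_power_coeff N (c mod N) l else 0)"
proof -
  let ?E = "rep_E (semicyclic_rep N b 0)" and ?F = "rep_F (semicyclic_rep N b 0)"
  note br = pair_index_bounds[OF r] and bc = pair_index_bounds[OF c]
  have "quasi_R N (semicyclic_rep N b 0) $$ (r, c)
      = (\<Sum>l<N. R_coeff N l * ((?E ^\<^sub>m l) $$ (r div N, c div N) * (?F ^\<^sub>m l) $$ (r mod N, c mod N)))"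
    unfolding quasi_R_entry[OF r c]
    by (simp only: kron_entry[OF pow_carrier_mat[OF semicyclic_carrier(1)]
      pow_carrier_mat[OF semicyclic_carrier(2)] r c])
  also have "\<dots> = (\<Sum>l<N. if r mod N + l = c mod N then R_coeff N l * (?E ^\<^sub>m l) $$ (r div N, c div N)
      * F_power_coeff N (c mod N) l else 0)"
    by (intro sum.cong) (auto simp: semicyclic_F_power_entry[OF br(2) bc(2)])
  also have "\<dots> = (\<Sum>l<N. if l = c mod N - r mod N then (if r mod N \<le> c mod N then
      R_coeff N l * (?E ^\<^sub>m l) $$ (r div N, c div N) * F_power_coeff N (c mod N) l else 0) else 0)"
    by (intro sum.cong) auto
  also have "\<dots> = (if r mod N \<le> c mod N then let l = c mod N - r mod N in
         R_coeff N l * (?E ^\<^sub>m l) $$ (r div N, c div N) * F_power_coeff N (c mod N) l else 0)"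
    using bc less_imp_diff_less[OF bc(2)] by (simp add: Let_def)
  finally show ?thesis .
qed

text \<open>All summands with \<open>l > 0\<close> strictly lower the index of the second tensor factor, and the
  summand with \<open>l = 0\<close> is the identity.  So the quasi-R-matrix is unitriangular once the two factors are
  exchanged and the basis is ordered by the second factor first.\<close>

lemma det_R_check_nonzero: "det (R_check N (semicyclic_rep N b 0)) \<noteq> 0"
proof -
  let ?n = "N * N" and ?\<rho> = "semicyclic_rep N b 0"
  let ?Q = "quasi_R N ?\<rho>" and ?P = "flip_mat N"
  let ?D = "q_HH_half N ?\<rho>"
  have D: "?D \<in> carrier_mat ?n ?n" by (simp add: q_HH_half_def)
  have PQ: "?P * ?Q \<in> carrier_mat ?n ?n" by (rule mult_carrier_mat[OF flip_mat_carrier quasi_R_carrier])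
  have M: "?P * ?Q * ?P \<in> carrier_mat ?n ?n" by (rule mult_carrier_mat[OF PQ flip_mat_carrier])
  have entry: "(?P * ?Q * ?P) $$ (r, c) = ?Q $$ (swap_index N r, swap_index N c)"
    if "r < ?n" "c < ?n" for r c
    using mult_flip_entry[OF PQ that] flip_mult_entry[OF quasi_R_carrier that(1) swap_index(1)[OF that(2)]]
    by simp
  have pow0: "(rep_E ?\<rho> ^\<^sub>m 0) $$ (x, y) = (if x = y then 1 else 0)" if "x < N" "y < N" for x y
    using that by (simp add: semicyclic_rep_def)
  have "upper_triangular (?P * ?Q * ?P)"
  proof (rule upper_triangularI)
    fix r c assume cr: "c < r" and "r < dim_row (?P * ?Q * ?P)"
    then have r: "r < ?n" and c: "c < ?n" by (auto simp: flip_mat_def)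
    have "c div N < r div N \<or> c div N = r div N \<and> c mod N \<noteq> r mod N"
      using cr div_le_mono[of c r N] by (metis div_mult_mod_eq le_neq_implies_less less_imp_le_nat nat_neq_iff)
    then show "(?P * ?Q * ?P) $$ (r, c) = 0"
      unfolding entry[OF r c] semicyclic_quasi_R_entry[OF swap_index(1)[OF r] swap_index(1)[OF c]]
        swap_index(2,3)[OF r] swap_index(2,3)[OF c]
      using pow0[OF pair_index_bounds(2)[OF r] pair_index_bounds(2)[OF c]] by (auto simp: Let_def)
  qed
  moreover have "0 \<notin> set (diag_mat (?P * ?Q * ?P))"
  proof -
    have "(?P * ?Q * ?P) $$ (r, r) = 1" if r: "r < ?n" for r
      unfolding entry[OF r r] semicyclic_quasi_R_entry[OF swap_index(1)[OF r] swap_index(1)[OF r]]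
        swap_index(2,3)[OF r]
      using pow0[OF pair_index_bounds(2)[OF r] pair_index_bounds(2)[OF r]] by (simp add: Let_def)
    then show ?thesis using carrier_matD[OF M] by (auto simp: diag_mat_def simp del: index_mult_mat)
  qed
  ultimately have "det (?P * ?Q * ?P) \<noteq> 0" using upper_triangular_imp_det_eq_0_iff[OF M] by blast
  then have PQ0: "det ?P \<noteq> 0" "det ?Q \<noteq> 0"
    unfolding det_mult[OF PQ flip_mat_carrier] det_mult[OF flip_mat_carrier quasi_R_carrier] by auto
  have "0 \<notin> set (diag_mat ?D)" by (auto simp: diag_mat_def q_HH_half_def)
  moreover have "upper_triangular ?D" by (rule upper_triangularI) (auto simp: q_HH_half_def)
  ultimately have "det ?D \<noteq> 0" using upper_triangular_imp_det_eq_0_iff[OF D] by blast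
  then show ?thesis
    unfolding R_check_def R_matrix_def det_mult[OF flip_mat_carrier mult_carrier_mat[OF D quasi_R_carrier]]
      det_mult[OF D quasi_R_carrier]
    using PQ0 by simp
qed

text \<open>The image of \<open>v\<^sub>k\<close> is this multiple of \<open>v\<^bsub>i+k\<^esub>\<close>.  The factor \<open>a\<close> appears after the wrap-around because
  \<open>E\<close> maps \<open>v\<^bsub>N-1\<^esub>\<close> to \<open>a v\<^sub>0\<close>; the powers of \<open>s\<close> turn the parameter \<open>b\<close> into \<open>s^N b\<close>, and \<open>\<gamma>\<close> is an
  overall scalar, free so that \<open>K\<close> itself is an instance.\<close>

definition shift_coeff :: "nat \<Rightarrow> complex \<Rightarrow> nat \<Rightarrow> complex \<Rightarrow> complex \<Rightarrow> nat \<Rightarrow> complex" where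
  "shift_coeff N a i s \<gamma> k = \<gamma> / s ^ k * (if i + k < N then 1 else a)"

abbreviation shift_op :: "nat \<Rightarrow> complex \<Rightarrow> nat \<Rightarrow> complex \<Rightarrow> complex \<Rightarrow> complex mat" where
  "shift_op N a i s \<gamma> \<equiv> monomial_op N (\<lambda>k. (i + k) mod N) (shift_coeff N a i s \<gamma>)"

abbreviation dual_shift_op :: "nat \<Rightarrow> complex \<Rightarrow> nat \<Rightarrow> complex \<Rightarrow> complex \<Rightarrow> complex mat" where
  "dual_shift_op N a i s \<gamma> \<equiv> monomial_op N (\<lambda>k. (i + k) mod N) (\<lambda>k. inverse (shift_coeff N a i s \<gamma> k))"

lemma cyclic_shift_inj:
  fixes i k k' N :: nat
  assumes "(i + k) mod N = (i + k') mod N" "i < N" "k < N" "k' < N"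
  shows "k = k'"
  using assms by (auto simp: mod_if split: if_splits)

text \<open>For \<open>E\<close> the condition \<open>a = s^N b\<close> is what closes the cycle at \<open>v\<^bsub>N-1\<^esub>\<close>.  For \<open>F\<close> the denominator \<open>a\<close> at
  \<open>v\<^sub>0\<close> cancels the factor \<open>a\<close> of the shifted basis vector.\<close>

lemma scaled_iso_shift:
  assumes "odd N" "i < N" "s \<noteq> 0" "\<gamma> \<noteq> 0" "i = 0 \<or> a \<noteq> 0" and a: "a = s ^ N * b"
  shows "scaled_iso N s (semicyclic_rep N b 0) (semicyclic_rep N a i)
    (shift_op N a i s \<gamma>) (dual_shift_op N a i s \<gamma>)"
proof
  have N: "N > 0" using assms by simp
  show "N > 0" "s \<noteq> 0" by fact+
  let ?g = "shift_coeff N a i s \<gamma>" and ?\<sigma> = "\<lambda>k. (i + k) mod N"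
  have g0: "?g k \<noteq> 0" if "k < N" for k
    using assms that by (auto simp: shift_coeff_def)
  have \<sigma>: "?\<sigma> c = (if i + c < N then i + c else i + c - N)" if "c < N" for c
    using that \<open>i < N\<close> by (auto simp: mod_if)
  show "transpose_mat (dual_shift_op N a i s \<gamma>) * shift_op N a i s \<gamma> = 1\<^sub>m N"
  proof (rule eq_matI)
    fix r c assume "r < dim_row (1\<^sub>m N :: complex mat)" "c < dim_col (1\<^sub>m N :: complex mat)"
    then have rc: "r < N" "c < N" by auto
    have "(transpose_mat (dual_shift_op N a i s \<gamma>) * shift_op N a i s \<gamma>) $$ (r, c)
        = transpose_mat (dual_shift_op N a i s \<gamma>) $$ (r, ?\<sigma> c) * ?g c"
      using mult_monomial_op_entry[of "transpose_mat (dual_shift_op N a i s \<gamma>)" N N r c ?\<sigma> ?g] rc N by simp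
    also have "\<dots> = (if ?\<sigma> c = ?\<sigma> r then inverse (?g r) else 0) * ?g c"
      using rc N carrier_matD[OF monomial_op_carrier[of N ?\<sigma> "\<lambda>k. inverse (?g k)"]] by simp
    also have "\<dots> = 1\<^sub>m N $$ (r, c)"
      using rc g0[of c] cyclic_shift_inj[of i r N c] \<open>i < N\<close> by auto
    finally show "(transpose_mat (dual_shift_op N a i s \<gamma>) * shift_op N a i s \<gamma>) $$ (r, c) = 1\<^sub>m N $$ (r, c)" .
  qed (simp_all add: monomial_op_def)
  show "rep_E (semicyclic_rep N a i) * shift_op N a i s \<gamma>
      = s \<cdot>\<^sub>m (shift_op N a i s \<gamma> * rep_E (semicyclic_rep N b 0))"
  proof -
    have "(if ?\<sigma> c < N - 1 then 1 else a) * ?g c = s * (?g ((c + 1) mod N) * (if c < N - 1 then 1 else b))"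
      if c: "c < N" for c
    proof (cases "c < N - 1")
      case True
      then show ?thesis unfolding \<sigma>[OF c] using \<open>i < N\<close> \<open>s \<noteq> 0\<close> by (auto simp: shift_coeff_def)
    next
      case False
      then have "N = Suc c" using c by simp
      then show ?thesis unfolding \<sigma>[OF c] using \<open>i < N\<close> \<open>s \<noteq> 0\<close> by (auto simp: shift_coeff_def a)
    qed
    moreover have "(?\<sigma> c + 1) mod N = ?\<sigma> ((c + 1) mod N)" for c by (simp add: mod_simps add_ac)
    ultimately show ?thesis
      unfolding semicyclic_E_monomial[OF N]
      by (subst (1 2) monomial_op_mult) (use N in \<open>auto simp: smult_monomial_op intro!: monomial_op_cong\<close>)
  qed
  show "s \<cdot>\<^sub>m (rep_F (semicyclic_rep N a i) * shift_op N a i s \<gamma>)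
      = shift_op N a i s \<gamma> * rep_F (semicyclic_rep N b 0)"
  proof -
    have F: "s * (semicyclic_F_coeff N a i (?\<sigma> c) * ?g c)
        = ?g ((c + N - 1) mod N) * semicyclic_F_coeff N b 0 c" if c: "c < N" for c
    proof -
      have k: "(?\<sigma> c + N - i) mod N = c" unfolding \<sigma>[OF c] using c \<open>i < N\<close> by auto
      show ?thesis
      proof (cases c)
        case 0
        then show ?thesis using N k by (simp add: semicyclic_F_coeff_0) (simp add: semicyclic_F_coeff_def)
      next
        case (Suc c')
        have p: "(c + N - 1) mod N = c'" using Suc c by simp
        have "?\<sigma> c = 0 \<longleftrightarrow> i + c = N" unfolding \<sigma>[OF c] using Suc by auto
        moreover have "a \<noteq> 0" if "i + c = N" using that assms c by auto
        ultimately show ?thesis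
          unfolding p semicyclic_F_coeff_0[OF c] unfolding semicyclic_F_coeff_def k
          using Suc \<open>s \<noteq> 0\<close> by (auto simp: shift_coeff_def Let_def)
      qed
    qed
    have "(?\<sigma> c + N - 1) mod N = ?\<sigma> ((c + N - 1) mod N)" if "c < N" for c
    proof -
      have "(?\<sigma> c + N - 1) mod N = (?\<sigma> c + (N - 1)) mod N" "c + N - 1 = c + (N - 1)" using N by auto
      then show ?thesis by (simp add: mod_simps add_ac)
    qed
    then show ?thesis
      unfolding semicyclic_F_monomial
      by (subst (1 2) monomial_op_mult) (use N F in \<open>auto simp: smult_monomial_op intro!: monomial_op_cong\<close>)
  qed
  show "even (rep_wt (semicyclic_rep N b 0) k)" "even (rep_wt (semicyclic_rep N a i) k)" for k
    using \<open>odd N\<close> by auto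
  show "2 * int N dvd rep_wt (semicyclic_rep N a i) r - rep_wt (semicyclic_rep N b 0) c"
    if "r < N" "c < N" "shift_op N a i s \<gamma> $$ (r, c) \<noteq> 0" for r c
  proof -
    have "c < N" "r = ?\<sigma> c" using that by (auto split: if_splits)
    then consider "r = i + c" | "r = i + c - N" "i + c \<ge> N" using \<sigma>[OF \<open>c < N\<close>] by (auto split: if_splits)
    then show ?thesis
    proof cases
      case 2
      then have "rep_wt (semicyclic_rep N a i) r - rep_wt (semicyclic_rep N b 0) c = 2 * int N * (- 1)"
        by (simp add: of_nat_diff)
      then show ?thesis by (metis dvd_triv_left)
    qed simp
  qed
qed (simp_all add: det_R_check_nonzero)

section \<open>The element K\<close>

text \<open>\<open>K\<close> multiplies \<open>v\<^sub>k\<close> by \<open>q^(1-N) q^(2k)\<close>, which is the shift with \<open>i = 0\<close> and \<open>s = q^(-2)\<close>; as \<open>s^N = 1\<close>, it leaves the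
  parameter unchanged.\<close>

lemma K_op_eq_shift:
  fixes N :: nat and b :: complex
  defines "s \<equiv> inverse (q_root N ^ 2)" and "\<gamma> \<equiv> q_root N powi (1 - int N)"
  assumes "N > 0"
  shows "shift_op N b 0 s \<gamma> = K_op N (semicyclic_rep N b 0)"
    "dual_shift_op N b 0 s \<gamma> = K_inv_op N (semicyclic_rep N b 0)"
proof -
  have *: "shift_coeff N b 0 s \<gamma> c = q_root N powi (1 - int N + 2 * int c)" if "c < N" for c
  proof -
    have "q_root N powi (1 - int N + int (2 * c)) = \<gamma> * q_root N powi int (2 * c)"
      unfolding \<gamma>_def by (rule power_int_add) simp
    also have "q_root N powi int (2 * c) = (q_root N ^ 2) ^ c"
      unfolding power_int_of_nat by (rule power_mult)
    finally show ?thesis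
      using that by (simp add: shift_coeff_def s_def field_simps)
  qed
  show "shift_op N b 0 s \<gamma> = K_op N (semicyclic_rep N b 0)"
    by (rule eq_matI) (auto simp: K_op_def diag_op_def monomial_op_def *)
  show "dual_shift_op N b 0 s \<gamma> = K_inv_op N (semicyclic_rep N b 0)"
    by (rule eq_matI) (auto simp: K_inv_op_def diag_op_def monomial_op_def * power_int_minus[symmetric])
qed

lemma scaled_iso_K:
  assumes "odd N"
  shows "scaled_iso N (inverse (q_root N ^ 2)) (semicyclic_rep N b 0) (semicyclic_rep N b 0)
    (K_op N (semicyclic_rep N b 0)) (K_inv_op N (semicyclic_rep N b 0))"
proof -
  have N: "N > 0" using assms by (cases N) auto
  have "(q_root N ^ 2) ^ N = (q_root N powi int N) ^ 2"
    unfolding power_int_of_nat by (simp add: power_mult[symmetric] mult.commute)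
  then have "(q_root N ^ 2) ^ N = 1" using q_root_powi_N[OF N] by simp
  then show ?thesis
    unfolding K_op_eq_shift[OF N, symmetric]
    by (intro scaled_iso_shift) (use assms N in \<open>auto simp: power_inverse\<close>)
qed

lemma semicyclic_diagram_op_carrier:
  assumes "one_one_tangle_diagram D"
  shows "diagram_op N (semicyclic_rep N b 0) [Down] D \<in> carrier_mat N N"
  using diagram_op_carrier[of "[Down]" D "[Down]" N, OF _ slice_op_carrier[OF det_R_check_nonzero]]
    assms by (simp add: one_one_tangle_diagram_def)

text \<open>The operator commutes with \<open>K\<close>, whose eigenvalues \<open>q^(1-N+2k)\<close> are distinct.\<close>

lemma semicyclic_diagram_op_diagonal:
  assumes "odd N" and D: "one_one_tangle_diagram D" and rc: "r < N" "c < N" "r \<noteq> c"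
  shows "diagram_op N (semicyclic_rep N b 0) [Down] D $$ (r, c) = 0"
proof -
  let ?\<rho> = "semicyclic_rep N b 0"
  interpret scaled_iso N "inverse (q_root N ^ 2)" ?\<rho> ?\<rho> "K_op N ?\<rho>" "K_inv_op N ?\<rho>"
    using scaled_iso_K[OF assms(1)] .
  let ?T = "diagram_op N ?\<rho> [Down] D"
  have T: "?T \<in> carrier_mat N N" by (rule semicyclic_diagram_op_carrier[OF D])
  have "?T * K_op N ?\<rho> = K_op N ?\<rho> * ?T"
    using diagram_op_comm[OF D[unfolded one_one_tangle_diagram_def]] by (simp add: kron_one_right)
  then have "?T $$ (r, c) * q_root N powi rep_wt ?\<rho> c = q_root N powi rep_wt ?\<rho> r * ?T $$ (r, c)"
    unfolding K_op_def using mult_diag_op_entry[OF T rc(1,2)] diag_op_mult_entry[OF T rc(1,2)] by metis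
  then have eq: "?T $$ (r, c) = 0 \<or> q_root N powi rep_wt ?\<rho> c = q_root N powi rep_wt ?\<rho> r" by auto
  have "q_root N powi rep_wt ?\<rho> c \<noteq> q_root N powi rep_wt ?\<rho> r"
  proof
    assume e: "q_root N powi rep_wt ?\<rho> c = q_root N powi rep_wt ?\<rho> r"
    have "q_root N powi (rep_wt ?\<rho> c - rep_wt ?\<rho> r) = 1"
      using e by (subst power_int_diff) auto
    then have "2 * int N dvd 2 * (int c - int r)"
      using q_root_powi_eq_1_iff[of N "2 * (int c - int r)"] rc by (simp add: algebra_simps)
    then have "int N dvd int c - int r" unfolding dvd_mult_cancel_left by simp
    then show False using rc dvd_imp_le_int[of "int c - int r" "int N"] by auto
  qed
  then show ?thesis using eq by auto
qed

section \<open>Continuity in the parameter\<close>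

definition entrywise_continuous :: "nat \<Rightarrow> nat \<Rightarrow> (complex \<Rightarrow> complex mat) \<Rightarrow> bool" where
  "entrywise_continuous n m A \<longleftrightarrow> (\<forall>b. A b \<in> carrier_mat n m)
     \<and> (\<forall>r<n. \<forall>c<m. continuous_on UNIV (\<lambda>b. A b $$ (r, c)))"

lemma entrywise_continuousI:
  assumes "\<And>b. A b \<in> carrier_mat n m"
    and "\<And>r c. r < n \<Longrightarrow> c < m \<Longrightarrow> continuous_on UNIV (\<lambda>b. A b $$ (r, c))"
  shows "entrywise_continuous n m A"
  using assms by (auto simp: entrywise_continuous_def)

lemma entrywise_continuousD:
  assumes "entrywise_continuous n m A"
  shows "A b \<in> carrier_mat n m"
    "r < n \<Longrightarrow> c < m \<Longrightarrow> continuous_on UNIV (\<lambda>b. A b $$ (r, c))"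
  using assms by (auto simp: entrywise_continuous_def)

lemma entrywise_continuous_const: "A \<in> carrier_mat n m \<Longrightarrow> entrywise_continuous n m (\<lambda>_. A)"
  by (auto simp: entrywise_continuous_def)

lemma entrywise_continuous_mult:
  assumes A: "entrywise_continuous n k A" and B: "entrywise_continuous k m B"
  shows "entrywise_continuous n m (\<lambda>b. A b * B b)"
proof (rule entrywise_continuousI)
  fix r c assume "r < n" "c < m"
  then show "continuous_on UNIV (\<lambda>b. (A b * B b) $$ (r, c))"
    unfolding mult_mat_entry[OF entrywise_continuousD(1)[OF A] entrywise_continuousD(1)[OF B] \<open>r < n\<close> \<open>c < m\<close>]
    by (auto intro!: continuous_on_sum continuous_on_mult entrywise_continuousD(2)[OF A]
      entrywise_continuousD(2)[OF B])
qed (rule mult_carrier_mat[OF entrywise_continuousD(1)[OF A] entrywise_continuousD(1)[OF B]])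

lemma entrywise_continuous_kron:
  assumes A: "entrywise_continuous n k A" and B: "entrywise_continuous n' k' B"
  shows "entrywise_continuous (n * n') (k * k') (\<lambda>b. kron (A b) (B b))"
proof (rule entrywise_continuousI)
  fix r c assume r: "r < n * n'" and c: "c < k * k'"
  show "continuous_on UNIV (\<lambda>b. kron (A b) (B b) $$ (r, c))"
    unfolding kron_entry[OF entrywise_continuousD(1)[OF A] entrywise_continuousD(1)[OF B] r c]
    by (intro continuous_on_mult entrywise_continuousD(2)[OF A] entrywise_continuousD(2)[OF B]
      pair_index_bounds[OF r] pair_index_bounds[OF c])
qed (rule kron_carrier[OF entrywise_continuousD(1)[OF A] entrywise_continuousD(1)[OF B]])

lemma entrywise_continuous_pow:
  assumes A: "entrywise_continuous n n A"
  shows "entrywise_continuous n n (\<lambda>b. A b ^\<^sub>m l)"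
proof (induction l)
  case 0
  have "A b ^\<^sub>m 0 = 1\<^sub>m n" for b using entrywise_continuousD(1)[OF A, of b] by simp
  then show ?case by (simp only:) (rule entrywise_continuous_const, simp)
next
  case (Suc l)
  show ?case unfolding pow_mat.simps by (rule entrywise_continuous_mult[OF Suc.IH A])
qed

lemma continuous_on_det:
  assumes A: "entrywise_continuous n n A"
  shows "continuous_on UNIV (\<lambda>b. det (A b))"
  unfolding det_def'[OF entrywise_continuousD(1)[OF A]]
  by (intro continuous_on_sum continuous_on_mult continuous_on_prod continuous_on_const
    entrywise_continuousD(2)[OF A]) (auto simp: permutes_in_image)

text \<open>By Cramer's rule the entries of the inverse are quotients of determinants.\<close>

lemma entrywise_continuous_inverse:
  assumes A: "entrywise_continuous n n A" and det: "\<And>b. det (A b) \<noteq> 0"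
  shows "entrywise_continuous n n (\<lambda>b. the (mat_inverse (A b)))"
proof (rule entrywise_continuousI)
  note car = entrywise_continuousD(1)[OF A]
  note inv = mat_inverse_of_det_nonzero[OF car det]
  show "the (mat_inverse (A b)) \<in> carrier_mat n n" for b by (rule inv(3))
  have delete: "entrywise_continuous (n - 1) (n - 1) (\<lambda>b. mat_delete (A b) i j)" for i j
  proof (rule entrywise_continuousI)
    show "continuous_on UNIV (\<lambda>b. mat_delete (A b) i j $$ (r, c))" if "r < n - 1" "c < n - 1" for r c
      unfolding mat_delete_def using that carrier_matD[OF car]
      by (auto intro!: entrywise_continuousD(2)[OF A])
  qed (rule mat_delete_carrier[OF car])
  fix r c assume rc: "r < n" "c < n"
  have "the (mat_inverse (A b)) $$ (r, c) = cofactor (A b) c r / det (A b)" for b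
  proof -
    let ?B = "the (mat_inverse (A b))"
    have "det (A b) \<cdot>\<^sub>m ?B = ?B * (det (A b) \<cdot>\<^sub>m 1\<^sub>m n)"
      using mult_smult_distrib[OF inv(3) one_carrier_mat, of b "det (A b)"] inv(3)[of b] by simp
    also have "\<dots> = (?B * A b) * adj_mat (A b)"
      unfolding adj_mat(2)[OF car, symmetric]
      by (rule assoc_mult_mat[symmetric, OF inv(3) car adj_mat(1)[OF car]])
    also have "\<dots> = adj_mat (A b)" using inv(2)[of b] adj_mat(1)[OF car, of b] by simp
    finally have "(det (A b) \<cdot>\<^sub>m ?B) $$ (r, c) = adj_mat (A b) $$ (r, c)" by simp
    then show ?thesis
      using rc carrier_matD[OF car, of b] carrier_matD[OF inv(3), of b] det[of b]
      by (simp add: adj_mat_def field_simps)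
  qed
  then show "continuous_on UNIV (\<lambda>b. the (mat_inverse (A b)) $$ (r, c))"
    by (simp only: cofactor_def)
      (intro continuous_on_divide continuous_on_mult continuous_on_const continuous_on_det[OF delete]
        continuous_on_det[OF A] ballI det)
qed

lemma semicyclic_R_check_continuous:
  assumes "N > 0"
  shows "entrywise_continuous (N * N) (N * N) (\<lambda>b. R_check N (semicyclic_rep N b 0))"
proof (rule entrywise_continuousI)
  have E: "entrywise_continuous N N (\<lambda>b. rep_E (semicyclic_rep N b 0))"
  proof (rule entrywise_continuousI)
    show "continuous_on UNIV (\<lambda>b. rep_E (semicyclic_rep N b 0) $$ (r, c))" if "r < N" "c < N" for r c
      using that by (cases "c < N - 1"; cases "r = 0") (auto simp: semicyclic_rep_def)
  qed simp
  note El = entrywise_continuousD(2)[OF entrywise_continuous_pow[OF E]]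
  fix r c assume r: "r < N * N" and c: "c < N * N"
  have phase: "HH_phase N (semicyclic_rep N b 0) j k
      = q_root N powr (of_int ((1 - int N + 2 * int j) * (1 - int N + 2 * int k)) / 2)" for b j k
    by simp
  show "continuous_on UNIV (\<lambda>b. R_check N (semicyclic_rep N b 0) $$ (r, c))"
    unfolding R_check_entry[OF r c] semicyclic_quasi_R_entry[OF swap_index(1)[OF r] c] Let_def phase
    using El[OF pair_index_bounds(1)[OF swap_index(1)[OF r]] pair_index_bounds(1)[OF c]]
    by (cases "swap_index N r mod N \<le> c mod N")
      (auto simp only: if_True if_False intro!: continuous_on_mult continuous_on_const)
qed (rule R_check_carrier)

lemma semicyclic_diagram_op_continuous:
  assumes "N > 0" "tangle_diagram s D t"
  shows "entrywise_continuous (N ^ length t) (N ^ length s)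
    (\<lambda>b. diagram_op N (semicyclic_rep N b 0) s D)"
  using assms(2)
proof (induction D arbitrary: s)
  case Nil
  then show ?case by (auto intro: entrywise_continuous_const)
next
  case (Cons x D)
  obtain ls p rs where x: "x = (ls, p, rs)" by (cases x) auto
  note R = semicyclic_R_check_continuous[OF assms(1)]
  have K: "K_op N (semicyclic_rep N b 0) = diag_op N (\<lambda>k. q_root N powi (1 - int N + 2 * int k))"
    "K_inv_op N (semicyclic_rep N b 0) = diag_op N (\<lambda>k. q_root N powi (- (1 - int N + 2 * int k)))" for b
    by (simp_all add: K_op_def K_inv_op_def)
  have piece: "entrywise_continuous (N ^ length (piece_top p)) (N ^ length (piece_bottom p))
      (\<lambda>b. piece_op N (semicyclic_rep N b 0) p)"
  proof (cases p)
    case PosCrossing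
    then show ?thesis using R by simp
  next
    case NegCrossing
    then show ?thesis using entrywise_continuous_inverse[OF R det_R_check_nonzero] by simp
  next
    case CupRL
    show ?thesis unfolding CupRL piece_op_cups_caps K
      by (rule entrywise_continuous_const) (simp add: cup_vec_def cap_row_def)
  next
    case CapRL
    show ?thesis unfolding CapRL piece_op_cups_caps K
      by (rule entrywise_continuous_const) (simp add: cup_vec_def cap_row_def)
  qed (simp_all add: entrywise_continuous_const)
  have "entrywise_continuous (N ^ length (slice_top x)) (N ^ length (slice_bottom x))
      (\<lambda>b. slice_op N (semicyclic_rep N b 0) x)"
    unfolding x slice_op.simps slice_top.simps slice_bottom.simps length_append power_add
    by (intro entrywise_continuous_kron entrywise_continuous_const piece one_carrier_mat)
  then show ?case
    using Cons.prems entrywise_continuous_mult[OF Cons.IH] by simp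
qed

section \<open>Equivariance of the standard representation under E\<close>

text \<open>The action of \<open>E\<close> on a tensor product: the iterated coproduct \<open>\<Delta>(E) = E \<otimes> K + 1 \<otimes> E\<close>, where
  \<open>X\<close> and \<open>Y\<close> give the actions of \<open>E\<close> and \<open>K\<close> on single strands.\<close>

fun word_E :: "nat \<Rightarrow> (strand \<Rightarrow> complex mat) \<Rightarrow> (strand \<Rightarrow> complex mat) \<Rightarrow> strand list \<Rightarrow> complex mat" where
  "word_E N X Y [] = 0\<^sub>m 1 1"
| "word_E N X Y (x # s) = kron (X x) (word_op Y s) + kron (1\<^sub>m N) (word_E N X Y s)"

lemma word_E_carrier:
  assumes X: "\<And>x. X x \<in> carrier_mat N N" and Y: "\<And>x. Y x \<in> carrier_mat N N"
  shows "word_E N X Y s \<in> carrier_mat (N ^ length s) (N ^ length s)"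
proof (induction s)
  case (Cons x s)
  have "word_op Y s \<in> carrier_mat (N ^ length s) (N ^ length s)"
    by (rule word_op_carrier) (rule Y)
  from kron_carrier[OF X this] kron_carrier[OF one_carrier_mat Cons.IH] show ?case
    by (simp only: word_E.simps length_Cons power_Suc) (rule add_carrier_mat)
qed simp

lemma kron_zero: "kron (0\<^sub>m a b) A = 0\<^sub>m (a * dim_row A) (b * dim_col A)"
  "kron A (0\<^sub>m a b) = 0\<^sub>m (dim_row A * a) (dim_col A * b)"
  by (rule eq_matI; auto simp: kron_def pair_index_bounds)+

lemma word_E_append:
  assumes X: "\<And>x. X x \<in> carrier_mat N N" and Y: "\<And>x. Y x \<in> carrier_mat N N"
  shows "word_E N X Y (s @ t) = kron (word_E N X Y s) (word_op Y t)
    + kron (1\<^sub>m (N ^ length s)) (word_E N X Y t)"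
proof (induction s)
  case Nil
  have W: "word_op Y t \<in> carrier_mat (N ^ length t) (N ^ length t)"
    by (rule word_op_carrier) (rule Y)
  show ?case
    using carrier_matD[OF W] left_add_zero_mat[OF word_E_carrier[of X N Y t, OF X Y]]
    by (simp add: kron_zero kron_one_left[simplified])
next
  case (Cons x s)
  have W: "word_op Y u \<in> carrier_mat (N ^ length u) (N ^ length u)" for u
    by (rule word_op_carrier) (rule Y)
  have E: "word_E N X Y u \<in> carrier_mat (N ^ length u) (N ^ length u)" for u
    by (rule word_E_carrier[OF X Y])
  note WW = kron_carrier[OF W W] and EW = kron_carrier[OF E W]
    and oE = kron_carrier[OF one_carrier_mat E]
  have "word_E N X Y ((x # s) @ t) = kron (kron (X x) (word_op Y s)) (word_op Y t)
     + kron (1\<^sub>m N) (kron (word_E N X Y s) (word_op Y t) + kron (1\<^sub>m (N ^ length s)) (word_E N X Y t))"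
    by (simp add: Cons.IH word_op_append kron_assoc)
  also have "kron (1\<^sub>m N) (kron (word_E N X Y s) (word_op Y t) + kron (1\<^sub>m (N ^ length s)) (word_E N X Y t))
    = kron (kron (1\<^sub>m N) (word_E N X Y s)) (word_op Y t) + kron (kron (1\<^sub>m N) (1\<^sub>m (N ^ length s))) (word_E N X Y t)"
    by (simp add: kron_add_right[OF EW oE one_carrier_mat] kron_assoc)
  also have "kron (kron (X x) (word_op Y s)) (word_op Y t)
     + (kron (kron (1\<^sub>m N) (word_E N X Y s)) (word_op Y t)
       + kron (kron (1\<^sub>m N) (1\<^sub>m (N ^ length s))) (word_E N X Y t))
    = kron (kron (X x) (word_op Y s)) (word_op Y t) + kron (kron (1\<^sub>m N) (word_E N X Y s)) (word_op Y t)
       + kron (kron (1\<^sub>m N) (1\<^sub>m (N ^ length s))) (word_E N X Y t)"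
    by (rule assoc_add_mat[symmetric, OF kron_carrier[OF kron_carrier[OF X W] W]
      kron_carrier[OF kron_carrier[OF one_carrier_mat E] W]
      kron_carrier[OF kron_carrier[OF one_carrier_mat one_carrier_mat] E]])
  also have "\<dots> = kron (word_E N X Y (x # s)) (word_op Y t) + kron (1\<^sub>m (N ^ length (x # s))) (word_E N X Y t)"
    by (simp add: kron_add_left[OF kron_carrier[OF X W] kron_carrier[OF one_carrier_mat E] W] kron_one)
  finally show ?case .
qed

lemma slice_op_word_E:
  assumes X: "\<And>x. X x \<in> carrier_mat N N" and Y: "\<And>x. Y x \<in> carrier_mat N N"
    and P: "P \<in> carrier_mat (N ^ length (piece_top p)) (N ^ length (piece_bottom p))"
    and commY: "P * word_op Y (piece_bottom p) = word_op Y (piece_top p) * P"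
    and commX: "P * word_E N X Y (piece_bottom p) = word_E N X Y (piece_top p) * P"
  shows "kron (1\<^sub>m (N ^ length ls)) (kron P (1\<^sub>m (N ^ length rs))) * word_E N X Y (ls @ piece_bottom p @ rs)
    = word_E N X Y (ls @ piece_top p @ rs) * kron (1\<^sub>m (N ^ length ls)) (kron P (1\<^sub>m (N ^ length rs)))"
proof -
  let ?W = "word_op Y" and ?E = "word_E N X Y" and ?b = "piece_bottom p" and ?t = "piece_top p"
  let ?l = "N ^ length ls" and ?r = "N ^ length rs"
  have W: "?W u \<in> carrier_mat (N ^ length u) (N ^ length u)" for u
    by (rule word_op_carrier) (rule Y)
  have E: "?E u \<in> carrier_mat (N ^ length u) (N ^ length u)" for u
    by (rule word_E_carrier[OF X Y])
  note o = one_carrier_mat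
  note P1 = kron_carrier[OF P o[of ?r]]
  have app: "?E (u @ v) = kron (?E u) (?W v) + kron (1\<^sub>m (N ^ length u)) (?E v)" for u v
    by (rule word_E_append) (rule X Y)+
  have split: "?E (ls @ u @ rs) = kron (?E ls) (kron (?W u) (?W rs))
      + kron (1\<^sub>m ?l) (kron (?E u) (?W rs) + kron (1\<^sub>m (N ^ length u)) (?E rs))" for u
    unfolding app word_op_append ..
  note cW = kron_carrier[OF W W]
  have in_u: "kron (?E u) (?W rs) + kron (1\<^sub>m (N ^ length u)) (?E rs)
      \<in> carrier_mat (N ^ length u * ?r) (N ^ length u * ?r)" for u
    by (rule add_carrier_mat[OF kron_carrier[OF o E]])
  have "kron (1\<^sub>m ?l) (kron P (1\<^sub>m ?r)) * ?E (ls @ ?b @ rs)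
      = kron (1\<^sub>m ?l) (kron P (1\<^sub>m ?r)) * kron (?E ls) (kron (?W ?b) (?W rs))
        + kron (1\<^sub>m ?l) (kron P (1\<^sub>m ?r))
          * kron (1\<^sub>m ?l) (kron (?E ?b) (?W rs) + kron (1\<^sub>m (N ^ length ?b)) (?E rs))"
    unfolding split
    by (rule mult_add_distrib_mat[OF kron_carrier[OF o P1] kron_carrier[OF E cW] kron_carrier[OF o in_u]])
  also have "\<dots> = kron (?E ls) (kron (P * ?W ?b) (?W rs))
      + kron (1\<^sub>m ?l) (kron (P * ?E ?b) (?W rs) + kron P (?E rs))"
    unfolding kron_mult[OF o E P1 cW] kron_mult[OF P W o W] kron_mult[OF o o P1 in_u]
      mult_add_distrib_mat[OF P1 kron_carrier[OF E W] kron_carrier[OF o E]]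
      kron_mult[OF P E o W] kron_mult[OF P o o E]
      left_mult_one_mat[OF E] left_mult_one_mat[OF W] left_mult_one_mat[OF o] right_mult_one_mat[OF P] ..
  also have "\<dots> = kron (?E ls) (kron (?W ?t * P) (?W rs))
      + kron (1\<^sub>m ?l) (kron (?E ?t * P) (?W rs) + kron P (?E rs))"
    unfolding commX commY ..
  also have "\<dots> = kron (?E ls) (kron (?W ?t) (?W rs)) * kron (1\<^sub>m ?l) (kron P (1\<^sub>m ?r))
      + kron (1\<^sub>m ?l) (kron (?E ?t) (?W rs) + kron (1\<^sub>m (N ^ length ?t)) (?E rs))
        * kron (1\<^sub>m ?l) (kron P (1\<^sub>m ?r))"
    unfolding kron_mult[OF E o cW P1] kron_mult[OF W P W o] kron_mult[OF o o in_u P1]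
      add_mult_distrib_mat[OF kron_carrier[OF E W] kron_carrier[OF o E] P1]
      kron_mult[OF E P W o] kron_mult[OF o P E o]
      right_mult_one_mat[OF E] right_mult_one_mat[OF W] left_mult_one_mat[OF o] left_mult_one_mat[OF P] ..
  also have "\<dots> = ?E (ls @ ?t @ rs) * kron (1\<^sub>m ?l) (kron P (1\<^sub>m ?r))"
    unfolding split
    by (rule add_mult_distrib_mat[symmetric, OF kron_carrier[OF E cW] kron_carrier[OF o in_u] kron_carrier[OF o P1]])
  finally show ?thesis .
qed

lemma cup_vec_add: "A \<in> carrier_mat N N \<Longrightarrow> B \<in> carrier_mat N N \<Longrightarrow> cup_vec N A + cup_vec N B = cup_vec N (A + B)"
  by (rule eq_matI) (auto simp: cup_vec_def pair_index_bounds)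

lemma cap_row_add: "A \<in> carrier_mat N N \<Longrightarrow> B \<in> carrier_mat N N \<Longrightarrow> cap_row N A + cap_row N B = cap_row N (A + B)"
  by (rule eq_matI) (auto simp: cap_row_def pair_index_bounds)

lemma cup_vec_zero: "cup_vec N (0\<^sub>m N N) = 0\<^sub>m (N * N) 1" "cap_row N (0\<^sub>m N N) = 0\<^sub>m 1 (N * N)"
  by (rule eq_matI; auto simp: cup_vec_def cap_row_def pair_index_bounds)+

text \<open>\<open>E\<close> acts on \<open>V*\<close> through the antipode \<open>S(E) = - E K\<^bsup>-1\<^esup>\<close>.\<close>

definition E_dual_op :: "nat \<Rightarrow> uq_rep \<Rightarrow> complex mat" where
  "E_dual_op N \<rho> = - transpose_mat (rep_E \<rho> * K_inv_op N \<rho>)"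

abbreviation strand_E :: "nat \<Rightarrow> uq_rep \<Rightarrow> strand \<Rightarrow> complex mat" where
  "strand_E N \<rho> \<equiv> strand_op (rep_E \<rho>) (E_dual_op N \<rho>)"

abbreviation strand_K :: "nat \<Rightarrow> uq_rep \<Rightarrow> strand \<Rightarrow> complex mat" where
  "strand_K N \<rho> \<equiv> strand_op (K_op N \<rho>) (K_inv_op N \<rho>)"

text \<open>The four cases are the antipode identities; the factors \<open>K\<close> and \<open>K\<^bsup>-1\<^esup>\<close> in the cap and cup from right to left
  make up for exchanging \<open>V\<close> with its dual.\<close>

lemma cups_caps_word_E:
  assumes E: "rep_E \<rho> \<in> carrier_mat N N" and p: "p \<in> {CupLR, CupRL, CapLR, CapRL}"
  shows "piece_op N \<rho> p * word_E N (strand_E N \<rho>) (strand_K N \<rho>) (piece_bottom p)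
    = word_E N (strand_E N \<rho>) (strand_K N \<rho>) (piece_top p) * piece_op N \<rho> p"
proof -
  let ?E = "rep_E \<rho>" and ?D = "E_dual_op N \<rho>" and ?K = "K_op N \<rho>" and ?L = "K_inv_op N \<rho>"
  note K = K_op_carrier(1)[of N \<rho>] and L = K_op_carrier(2)[of N \<rho>] and o = one_carrier_mat[of N]
  have EL: "?E * ?L \<in> carrier_mat N N" by (rule mult_carrier_mat[OF E L])
  have D: "?D \<in> carrier_mat N N" unfolding E_dual_op_def using EL by simp
  have Et: "transpose_mat ?E \<in> carrier_mat N N" using E by simp
  have LEt: "?L * transpose_mat ?E \<in> carrier_mat N N" by (rule mult_carrier_mat[OF L Et])
  have D1: "?D = - (?L * transpose_mat ?E)"
    unfolding E_dual_op_def transpose_mult[OF E L] by simp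
  have Dt: "transpose_mat ?D = - (?E * ?L)"
    unfolding E_dual_op_def by (rule eq_matI) (use EL in auto)
  have ELK: "?E * ?L * ?K = ?E" unfolding assoc_mult_mat[OF E L K] K_op_inverse by (rule right_mult_one_mat[OF E])
  have KLE: "?K * (?L * transpose_mat ?E) = transpose_mat ?E"
    unfolding assoc_mult_mat[OF K L Et, symmetric] K_op_inverse by (rule left_mult_one_mat[OF Et])
  have cancel: "A + - A = 0\<^sub>m N N" "- A + A = 0\<^sub>m N N" if "A \<in> carrier_mat N N" for A :: "complex mat"
    by (rule eq_matI; use that in auto)+
  have two: "word_E N (strand_E N \<rho>) (strand_K N \<rho>) [x, y] = kron (strand_E N \<rho> x) (strand_K N \<rho> y)
      + kron (1\<^sub>m N) (strand_E N \<rho> y)" for x y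
  proof -
    have y: "strand_E N \<rho> y \<in> carrier_mat N N" by (cases y) (simp_all add: E D)
    have "strand_E N \<rho> y + 0\<^sub>m (N * 1) (N * 1) = strand_E N \<rho> y" using y by simp
    then show ?thesis by (simp add: kron_one_right kron_zero)
  qed
  consider "p = CupLR" | "p = CupRL" | "p = CapLR" | "p = CapRL" using p by auto
  then show ?thesis
  proof cases
    case 1
    have "(kron ?E ?L + kron (1\<^sub>m N) ?D) * cup_vec N (1\<^sub>m N) = cup_vec N (?E * ?L + - (?E * ?L))"
      unfolding add_mult_distrib_mat[OF kron_carrier[OF E L] kron_carrier[OF o D] cup_vec_carrier]
        kron_mult_cup_vec[OF E L o] kron_mult_cup_vec[OF o D o] right_mult_one_mat[OF E]
        left_mult_one_mat[OF o] transpose_K_op Dt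
      using cup_vec_add[OF EL uminus_carrier_mat[OF EL]] left_mult_one_mat[OF uminus_carrier_mat[OF EL]] by simp
    then show ?thesis
      unfolding 1 piece_op_cups_caps piece_bottom.simps piece_top.simps two word_E.simps(1)
        strand_op_simps cancel(1)[OF EL] cup_vec_zero right_mult_zero_mat[OF cup_vec_carrier] by (rule sym)
  next
    case 2
    have "?D * ?L * ?K = ?D"
      unfolding assoc_mult_mat[OF D L K] K_op_inverse by (rule right_mult_one_mat[OF D])
    then have "(kron ?D ?K + kron (1\<^sub>m N) ?E) * cup_vec N ?L = cup_vec N (- (?L * transpose_mat ?E) + ?L * transpose_mat ?E)"
      unfolding add_mult_distrib_mat[OF kron_carrier[OF D K] kron_carrier[OF o E] cup_vec_carrier]
        kron_mult_cup_vec[OF D K L] kron_mult_cup_vec[OF o E L] left_mult_one_mat[OF L] transpose_K_op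
      using cup_vec_add[OF uminus_carrier_mat[OF LEt] LEt] D1 by simp
    then show ?thesis
      unfolding 2 piece_op_cups_caps piece_bottom.simps piece_top.simps two word_E.simps(1)
        strand_op_simps cancel(2)[OF LEt] cup_vec_zero right_mult_zero_mat[OF cup_vec_carrier] by (rule sym)
  next
    case 3
    have "- (?E * ?L) * ?K = - ?E" unfolding uminus_mult_left_mat[OF trans[OF carrier_matD(2)[OF EL] carrier_matD(1)[OF K, symmetric]]] ELK ..
    then have "cap_row N (1\<^sub>m N) * (kron ?D ?K + kron (1\<^sub>m N) ?E) = cap_row N (- ?E + ?E)"
      unfolding mult_add_distrib_mat[OF cap_row_carrier kron_carrier[OF D K] kron_carrier[OF o E]]
        cap_row_mult_kron[OF D K o] cap_row_mult_kron[OF o E o] Dt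
        right_mult_one_mat[OF uminus_carrier_mat[OF EL]]
      using cap_row_add[OF uminus_carrier_mat[OF E] E] left_mult_one_mat[OF E] by simp
    then show ?thesis
      unfolding 3 piece_op_cups_caps piece_bottom.simps piece_top.simps two word_E.simps(1)
        strand_op_simps cancel(2)[OF E] cup_vec_zero left_mult_zero_mat[OF cap_row_carrier] by this
  next
    case 4
    have a: "transpose_mat ?E * ?K * ?L = transpose_mat ?E"
      unfolding assoc_mult_mat[OF Et K L] K_op_inverse by (rule right_mult_one_mat[OF Et])
    have b: "?K * ?D = - transpose_mat ?E"
      unfolding D1 uminus_mult_right_mat[OF trans[OF carrier_matD(2)[OF K] carrier_matD(1)[OF LEt, symmetric]]] KLE ..
    have "cap_row N ?K * (kron ?E ?L + kron (1\<^sub>m N) ?D) = cap_row N (transpose_mat ?E + - transpose_mat ?E)"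
      unfolding mult_add_distrib_mat[OF cap_row_carrier kron_carrier[OF E L] kron_carrier[OF o D]]
        cap_row_mult_kron[OF E L K] cap_row_mult_kron[OF o D K] a transpose_one left_mult_one_mat[OF K] b
      using cap_row_add[OF Et uminus_carrier_mat[OF Et]] by simp
    then show ?thesis
      unfolding 4 piece_op_cups_caps piece_bottom.simps piece_top.simps two word_E.simps(1)
        strand_op_simps cancel(1)[OF Et] cup_vec_zero left_mult_zero_mat[OF cap_row_carrier] by this
  qed
qed

lemma standard_E_power_entry:
  assumes "r < N" "c < N"
  shows "(rep_E (semicyclic_rep N 0 0) ^\<^sub>m l) $$ (r, c) = (if r = c + l then 1 else 0)"
  using assms
proof (induction l arbitrary: c)
  case 0
  then show ?case by (simp add: semicyclic_rep_def)
next
  case (Suc l)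
  let ?E = "rep_E (semicyclic_rep N 0 0)"
  have N: "N > 0" using Suc.prems by simp
  have E: "?E ^\<^sub>m l \<in> carrier_mat N N" by (intro pow_carrier_mat semicyclic_carrier)
  have "(?E ^\<^sub>m Suc l) $$ (r, c) = (?E ^\<^sub>m l) $$ (r, (c + 1) mod N) * (if c < N - 1 then 1 else 0)"
    unfolding pow_mat.simps unfolding semicyclic_E_monomial[OF N]
    by (rule mult_monomial_op_entry[OF E[unfolded semicyclic_E_monomial[OF N]]]) (use Suc.prems in auto)
  moreover have "Suc c < N" if "c < N - 1" using that by simp
  ultimately show ?case using Suc.prems Suc.IH[of "c + 1"] by auto
qed

text \<open>The coefficient of \<open>v\<^sub>s \<otimes> v\<^sub>t\<close> in the image of \<open>v\<^sub>j \<otimes> v\<^sub>k\<close> under the crossing of the standard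
  representation: only the summand with \<open>l = k - s\<close> contributes.\<close>

definition crossing_coeff :: "nat \<Rightarrow> nat \<Rightarrow> nat \<Rightarrow> nat \<Rightarrow> nat \<Rightarrow> complex" where
  "crossing_coeff N s t j k = q_root N powr (of_int ((1 - int N + 2 * int t) * (1 - int N + 2 * int s)) / 2)
     * (if s \<le> k \<and> t = j + (k - s) then R_coeff N (k - s) * F_power_coeff N k (k - s) else 0)"

lemma standard_R_check_entry:
  assumes "s < N" "t < N" "j < N" "k < N"
  shows "R_check N (semicyclic_rep N 0 0) $$ (s * N + t, j * N + k) = crossing_coeff N s t j k"
proof -
  have r: "s * N + t < N * N" and c: "j * N + k < N * N" using assms by (auto intro: pair_index_less)
  have d: "(s * N + t) mod N = t" "(s * N + t) div N = s" "(j * N + k) mod N = k" "(j * N + k) div N = j"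
    using assms by auto
  have r': "t * N + s < N * N" using assms by (auto intro: pair_index_less)
  have d': "(t * N + s) mod N = s" "(t * N + s) div N = t" using assms by auto
  have "quasi_R N (semicyclic_rep N 0 0) $$ (t * N + s, j * N + k)
      = (if s \<le> k \<and> t = j + (k - s) then R_coeff N (k - s) * F_power_coeff N k (k - s) else 0)"
    unfolding semicyclic_quasi_R_entry[OF r' c] d d' Let_def standard_E_power_entry[OF assms(2,3)]
    by (simp del: add_diff_assoc add_diff_assoc2)
  then show ?thesis
    unfolding R_check_entry[OF r c] d crossing_coeff_def by simp
qed

lemma mult_kron_unit_entry:
  assumes M: "M \<in> carrier_mat m (N * N)" and A: "A \<in> carrier_mat N N" and B: "B \<in> carrier_mat N N"
    and idx: "r < m" "j < N" "k < N"
    and Aj: "\<And>x. x < N \<Longrightarrow> A $$ (x, j) = (if x = x\<^sub>0 then \<alpha> else 0)"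
    and Bk: "\<And>y. y < N \<Longrightarrow> B $$ (y, k) = (if y = y\<^sub>0 then \<beta> else 0)"
  shows "(M * kron A B) $$ (r, j * N + k)
    = (if x\<^sub>0 < N \<and> y\<^sub>0 < N then M $$ (r, x\<^sub>0 * N + y\<^sub>0) * (\<alpha> * \<beta>) else 0)"
proof -
  have c: "j * N + k < N * N" using idx by (auto intro: pair_index_less)
  have "(M * kron A B) $$ (r, j * N + k)
      = (\<Sum>l<N * N. M $$ (r, l div N * N + l mod N) * (A $$ (l div N, j) * B $$ (l mod N, k)))"
    unfolding mult_mat_entry[OF M kron_carrier[OF A B] idx(1) c]
    by (intro sum.cong) (use idx c kron_entry[OF A B] in auto)
  also have "\<dots> = (\<Sum>x<N. \<Sum>y<N. M $$ (r, x * N + y) * (A $$ (x, j) * B $$ (y, k)))"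
    by (rule sum_pair_index)
  also have "\<dots> = (\<Sum>x<N. if x = x\<^sub>0 then (if y\<^sub>0 < N then M $$ (r, x * N + y\<^sub>0) * (\<alpha> * \<beta>) else 0) else 0)"
  proof (rule sum.cong[OF refl])
    fix x assume "x \<in> {..<N}"
    have "(\<Sum>y<N. M $$ (r, x * N + y) * (A $$ (x, j) * B $$ (y, k)))
        = (\<Sum>y<N. if y = y\<^sub>0 then M $$ (r, x * N + y) * (A $$ (x, j) * \<beta>) else 0)"
      by (rule sum.cong) (auto simp: Bk)
    then show "(\<Sum>y<N. M $$ (r, x * N + y) * (A $$ (x, j) * B $$ (y, k)))
        = (if x = x\<^sub>0 then (if y\<^sub>0 < N then M $$ (r, x * N + y\<^sub>0) * (\<alpha> * \<beta>) else 0) else 0)"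
      using \<open>x \<in> {..<N}\<close> by (simp add: Aj)
  qed
  also have "\<dots> = (if x\<^sub>0 < N \<and> y\<^sub>0 < N then M $$ (r, x\<^sub>0 * N + y\<^sub>0) * (\<alpha> * \<beta>) else 0)"
    by simp
  finally show ?thesis .
qed

lemma kron_unit_mult_entry:
  assumes M: "M \<in> carrier_mat (N * N) m" and A: "A \<in> carrier_mat N N" and B: "B \<in> carrier_mat N N"
    and idx: "s < N" "t < N" "c < m"
    and As: "\<And>x. x < N \<Longrightarrow> A $$ (s, x) = (if x = x\<^sub>0 then \<alpha> else 0)"
    and Bt: "\<And>y. y < N \<Longrightarrow> B $$ (t, y) = (if y = y\<^sub>0 then \<beta> else 0)"
  shows "(kron A B * M) $$ (s * N + t, c)
    = (if x\<^sub>0 < N \<and> y\<^sub>0 < N then (\<alpha> * \<beta>) * M $$ (x\<^sub>0 * N + y\<^sub>0, c) else 0)"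
proof -
  have r: "s * N + t < N * N" using idx by (auto intro: pair_index_less)
  have "(kron A B * M) $$ (s * N + t, c)
      = (\<Sum>l<N * N. A $$ (s, l div N) * B $$ (t, l mod N) * M $$ (l div N * N + l mod N, c))"
    unfolding mult_mat_entry[OF kron_carrier[OF A B] M r idx(3)]
    by (intro sum.cong) (use idx r kron_entry[OF A B] in auto)
  also have "\<dots> = (\<Sum>x<N. \<Sum>y<N. A $$ (s, x) * B $$ (t, y) * M $$ (x * N + y, c))"
    by (rule sum_pair_index)
  also have "\<dots> = (\<Sum>x<N. if x = x\<^sub>0 then (if y\<^sub>0 < N then \<alpha> * \<beta> * M $$ (x * N + y\<^sub>0, c) else 0) else 0)"
  proof (rule sum.cong[OF refl])
    fix x assume "x \<in> {..<N}"
    have "(\<Sum>y<N. A $$ (s, x) * B $$ (t, y) * M $$ (x * N + y, c))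
        = (\<Sum>y<N. if y = y\<^sub>0 then A $$ (s, x) * \<beta> * M $$ (x * N + y, c) else 0)"
      by (rule sum.cong) (auto simp: Bt)
    then show "(\<Sum>y<N. A $$ (s, x) * B $$ (t, y) * M $$ (x * N + y, c))
        = (if x = x\<^sub>0 then (if y\<^sub>0 < N then \<alpha> * \<beta> * M $$ (x * N + y\<^sub>0, c) else 0) else 0)"
      using \<open>x \<in> {..<N}\<close> by (simp add: As)
  qed
  also have "\<dots> = (if x\<^sub>0 < N \<and> y\<^sub>0 < N then (\<alpha> * \<beta>) * M $$ (x\<^sub>0 * N + y\<^sub>0, c) else 0)"
    by simp
  finally show ?thesis .
qed

text \<open>Beyond the common factor \<open>F_power_coeff N k m\<close>, the two occurrences of \<open>F_power_coeff\<close> with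
  \<open>Suc m\<close> contribute \<open>[k+1][N-k-1] = [k+1]^2\<close> and \<open>[s][N-s] = [s]^2\<close>.  Their difference
  \<open>[m+1][k+1+s]\<close> is the commutator of \<open>E\<close> with \<open>F^(m+1)\<close> in this basis, and the recursion for the
  coefficients of the R-matrix removes \<open>[m+1]\<close>.\<close>

lemma crossing_coeff_step:
  assumes s: "s = k - m" and mk: "m \<le> k" and k: "k < N" and m: "Suc m < N"
  shows "R_coeff N (Suc m) * F_power_coeff N (Suc k) (Suc m)
      + R_coeff N m * F_power_coeff N k m * q_root N powi (1 - int N + 2 * int k)
    = R_coeff N (Suc m) * F_power_coeff N k (Suc m)
      + R_coeff N m * F_power_coeff N k m * q_root N powi (- (1 - int N + 2 * int s))"
proof -
  let ?q = "q_root N" and ?f = "F_power_coeff N k m"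
  define d where "d = ?q - inverse ?q"
  have d0: "d \<noteq> 0" using q_root_minus_inverse_nonzero[of N] m by (simp add: d_def)
  have N: "N > 0" using k by simp
  have add: "?q powi (x + y) = ?q powi x * ?q powi y" for x y by (rule power_int_add) simp
  have br: "qint N l = (?q powi int l - ?q powi (- int l)) / d" for l
    by (simp add: qint_def d_def)
  have km: "k - m = s" using s mk by simp
  have sq: "qint N (Suc k) * qint N (Suc k) - qint N s * qint N s = qint N (Suc m) * qint N (Suc k + s)"
  proof -
    have e: "int (Suc k) = int (Suc m) + int s" using s mk by simp
    have e2: "int (Suc k + s) = int (Suc m) + (int s + int s)" using s mk by simp
    have inv: "?q powi (- x) = inverse (?q powi x)" for x by (simp add: power_int_minus)
    have id: "(u * v - u' * v') * (u * v - u' * v') - (v - v') * (v - v')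
        = (u - u') * (u * (v * v) - u' * (v' * v'))" if "u * u' = 1" for u v u' v' :: complex
    proof -
      have "(u * v - u' * v') * (u * v - u' * v') - (v - v') * (v - v')
        = (u - u') * (u * (v * v) - u' * (v' * v')) + (u * u' - 1) * ((v - v') * (v - v'))"
        by (simp add: algebra_simps)
      then show ?thesis using that by simp
    qed
    show ?thesis
      unfolding br e e2 inv add inverse_mult_distrib times_divide_times_eq diff_divide_distrib[symmetric]
      by (subst id) (simp_all del: power_int_of_nat)
  qed
  have f1: "F_power_coeff N (Suc k) (Suc m) = qint N (Suc k) * qint N (Suc k) * ?f"
    unfolding F_power_coeff_Suc using qint_complement[of "Suc k" N] k N by simp
  have f2: "F_power_coeff N k (Suc m) = ?f * (qint N s * qint N s)"
    unfolding F_power_coeff.simps km using qint_complement[of s N] s k N by simp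
  have "R_coeff N (Suc m) * F_power_coeff N (Suc k) (Suc m) - R_coeff N (Suc m) * F_power_coeff N k (Suc m)
      = (R_coeff N (Suc m) * qint N (Suc m)) * qint N (Suc k + s) * ?f"
    unfolding f1 f2 using arg_cong[OF sq, of "\<lambda>x. R_coeff N (Suc m) * x * ?f"] by (simp add: algebra_simps)
  also have "\<dots> = R_coeff N m * ?f * (?q ^ m * (?q powi int (Suc k + s) - ?q powi (- int (Suc k + s))))"
  proof -
    have "?q powi int (Suc k + s) - ?q powi (- int (Suc k + s)) = d * qint N (Suc k + s)"
      unfolding br using d0 by simp
    then show ?thesis unfolding R_coeff_Suc[OF m] d_def[symmetric] by (simp only: mult_ac)
  qed
  also have "?q ^ m * (?q powi int (Suc k + s) - ?q powi (- int (Suc k + s)))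
      = ?q powi (1 + 2 * int k) - ?q powi (- 1 - 2 * int s)"
  proof -
    have "?q ^ m = ?q powi int m" by simp
    moreover have "int m + int (Suc k + s) = 1 + 2 * int k" "int m + - int (Suc k + s) = - 1 - 2 * int s"
      using s mk by auto
    ultimately show ?thesis by (simp only: right_diff_distrib add[symmetric])
  qed
  also have "?q powi (1 + 2 * int k) = - (?q powi (1 - int N + 2 * int k))"
    using add[of "1 - int N + 2 * int k" "int N"] q_root_powi_N[OF N] by (simp add: algebra_simps)
  also have "?q powi (- 1 - 2 * int s) = - (?q powi (- (1 - int N + 2 * int s)))"
    using add[of "- 1 - 2 * int s" "int N"] q_root_powi_N[OF N] by (simp add: algebra_simps)
  finally show ?thesis by (simp add: algebra_simps)
qed

text \<open>The coefficient of \<open>v\<^sub>s \<otimes> v\<^sub>t\<close> in the two images of \<open>v\<^sub>j \<otimes> v\<^sub>k\<close> under the crossing and \<open>\<Delta>(E)\<close>, composed in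
  either order.  The conditions on the summands express that \<open>E v\<^bsub>N-1\<^esub> = 0\<close> and that \<open>v\<^sub>0\<close> is not in the image
  of \<open>E\<close>.\<close>

lemma crossing_coeff_swap:
  assumes "j < N" "k < N" "s < N" "t < N"
  shows "(if j + 1 < N then crossing_coeff N s t (j + 1) k * q_root N powi (1 - int N + 2 * int k) else 0)
      + (if k + 1 < N then crossing_coeff N s t j (k + 1) else 0)
    = (if s > 0 then q_root N powi (1 - int N + 2 * int t) * crossing_coeff N (s - 1) t j k else 0)
      + (if t > 0 then crossing_coeff N s (t - 1) j k else 0)"
proof -
  let ?h = "\<lambda>x::nat. 1 - int N + 2 * int x"
  let ?ph = "\<lambda>s t. q_root N powr (of_int (?h t * ?h s) / 2)"
  let ?c = "\<lambda>k l. R_coeff N l * F_power_coeff N k l"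
  \<comment> \<open>lowering one weight by \<open>2\<close> multiplies the phase by \<open>q\<close> to the power minus the other weight\<close>
  have ph_t: "?ph s (t - 1) = ?ph s t * q_root N powi (- ?h s)" if "t > 0" for s t
  proof -
    have "of_int (?h (t - 1) * ?h s) / 2 = (of_int (?h t * ?h s) / 2 + of_int (- ?h s) :: complex)"
      using that by (simp add: of_nat_diff field_simps)
    then show ?thesis by (simp only: powr_add q_root_powr_of_int)
  qed
  have ph_s: "q_root N powi ?h t * ?ph (s - 1) t = ?ph s t" if "s > 0" for s t
  proof -
    have "q_root N powi ?h t * q_root N powi (- ?h t) = 1"
      by (subst power_int_add[symmetric]) auto
    then show ?thesis using ph_t[OF that, of t] by (simp add: mult.commute[of "1 - _ + _" "1 - _ + _"])
  qed
  show ?thesis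
  proof (cases "s + t = j + k + 1 \<and> s \<le> k + 1")
    case False
    then have z: "\<not> (s \<le> k \<and> t = j + 1 + (k - s))" "\<not> (s \<le> k + 1 \<and> t = j + (k + 1 - s))"
      "s > 0 \<Longrightarrow> \<not> (s - 1 \<le> k \<and> t = j + (k - (s - 1)))" "t > 0 \<Longrightarrow> \<not> (s \<le> k \<and> t - 1 = j + (k - s))"
      by auto
    have "crossing_coeff N s t (j + 1) k = 0" "crossing_coeff N s t j (k + 1) = 0"
      unfolding crossing_coeff_def if_not_P[OF z(1)] if_not_P[OF z(2)] by (rule mult_zero_right)+
    moreover have "crossing_coeff N (s - 1) t j k = 0" if "s > 0"
      unfolding crossing_coeff_def if_not_P[OF z(3)[OF that]] by (rule mult_zero_right)
    moreover have "crossing_coeff N s (t - 1) j k = 0" if "t > 0"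
      unfolding crossing_coeff_def if_not_P[OF z(4)[OF that]] by (rule mult_zero_right)
    ultimately show ?thesis by (simp only: mult_zero_left mult_zero_right if_cancel cong: if_cong)
  next
    case st: True
    show ?thesis
    proof (cases "s = k + 1")
      case True
      then have "t = j" using st by simp
      then show ?thesis unfolding crossing_coeff_def using True assms ph_s[of s t] by auto
    next
      case False
      define m where "m = k - s"
      have m: "m \<le> k" "s = k - m" "k - s = m" "k + 1 - s = Suc m" "t = j + Suc m" "Suc m < N" "s \<le> k"
        using st False assms by (auto simp: m_def)
      have 1: "(if j + 1 < N then crossing_coeff N s t (j + 1) k * q_root N powi ?h k else 0)
          = ?ph s t * (?c k m * q_root N powi ?h k)"
        using m assms by (simp add: crossing_coeff_def)
      have 2: "(if k + 1 < N then crossing_coeff N s t j (k + 1) else 0) = ?ph s t * ?c (Suc k) (Suc m)"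
      proof (cases "k + 1 < N")
        case True
        then show ?thesis using m by (simp add: crossing_coeff_def)
      next
        case False
        \<comment> \<open>here \<open>[N - (k + 1)] = 0\<close>, which agrees with \<open>E v\<^bsub>N-1\<^esub> = 0\<close>\<close>
        then have "N = Suc k" using assms by simp
        then show ?thesis by (simp add: F_power_coeff_Suc del: F_power_coeff.simps(2))
      qed
      have 3: "(if s > 0 then q_root N powi ?h t * crossing_coeff N (s - 1) t j k else 0)
          = ?ph s t * ?c k (Suc m)"
      proof (cases "s > 0")
        case True
        then have "k - (s - 1) = Suc m" "s - 1 \<le> k" using m by auto
        then have "crossing_coeff N (s - 1) t j k = ?ph (s - 1) t * ?c k (Suc m)"
          using m by (simp add: crossing_coeff_def)
        then show ?thesis using True ph_s[OF True, of t] by (simp add: mult.assoc[symmetric])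
      next
        case False
        \<comment> \<open>here \<open>F_power_coeff\<close> contains the factor \<open>[k - m] = [0]\<close>\<close>
        then have "k - m = 0" using m by simp
        then show ?thesis using False by simp
      qed
      have 4: "(if t > 0 then crossing_coeff N s (t - 1) j k else 0)
          = ?ph s t * (?c k m * q_root N powi (- ?h s))"
      proof -
        have "t > 0" "t - 1 = j + m" using m by auto
        then have "crossing_coeff N s (t - 1) j k = ?ph s (t - 1) * ?c k m"
          using m by (simp add: crossing_coeff_def)
        then show ?thesis using \<open>t > 0\<close> ph_t[OF \<open>t > 0\<close>, of s] by (simp only: if_True mult_ac)
      qed
      show ?thesis
        unfolding 1 2 3 4
        using crossing_coeff_step[OF m(2,1) assms(2) m(6)]
        by (simp only: distrib_left[symmetric] add.commute)
    qed
  qed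
qed

lemma standard_R_check_E:
  fixes N :: nat
  defines "\<rho> \<equiv> semicyclic_rep N 0 0"
  shows "R_check N \<rho> * (kron (rep_E \<rho>) (K_op N \<rho>) + kron (1\<^sub>m N) (rep_E \<rho>))
    = (kron (rep_E \<rho>) (K_op N \<rho>) + kron (1\<^sub>m N) (rep_E \<rho>)) * R_check N \<rho>"
proof (rule eq_matI)
  let ?M = "R_check N \<rho>" and ?E = "rep_E \<rho>" and ?K = "K_op N \<rho>"
  have E: "?E \<in> carrier_mat N N" by (simp add: \<rho>_def)
  note M = R_check_carrier[of N \<rho>] and K = K_op_carrier(1)[of N \<rho>] and o = one_carrier_mat[of N]
  note EK = kron_carrier[OF E K] and oE = kron_carrier[OF o E]
  show "dim_row (?M * (kron ?E ?K + kron (1\<^sub>m N) ?E)) = dim_row ((kron ?E ?K + kron (1\<^sub>m N) ?E) * ?M)"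
    "dim_col (?M * (kron ?E ?K + kron (1\<^sub>m N) ?E)) = dim_col ((kron ?E ?K + kron (1\<^sub>m N) ?E) * ?M)"
    using carrier_matD[OF M] carrier_matD[OF E] carrier_matD[OF K] by auto
  fix r c assume "r < dim_row ((kron ?E ?K + kron (1\<^sub>m N) ?E) * ?M)"
    "c < dim_col ((kron ?E ?K + kron (1\<^sub>m N) ?E) * ?M)"
  then have r: "r < N * N" and c: "c < N * N"
    using carrier_matD[OF M] carrier_matD[OF E] carrier_matD[OF K] by auto
  define s t j k where "s = r div N" and "t = r mod N" and "j = c div N" and "k = c mod N"
  have stjk: "s < N" "t < N" "j < N" "k < N"
    using pair_index_bounds[OF r] pair_index_bounds[OF c] by (auto simp: s_def t_def j_def k_def)
  have rc: "r = s * N + t" "c = j * N + k" by (auto simp: s_def t_def j_def k_def)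
  let ?q = "\<lambda>x::nat. q_root N powi (1 - int N + 2 * int x)"
  have Ecol: "?E $$ (x, j) = (if x = j + 1 then 1 else 0)" if "x < N" "j < N" for x j
    using that by (auto simp: \<rho>_def semicyclic_rep_def)
  have Erow: "?E $$ (s, x) = (if x = s - 1 then (if s > 0 then 1 else 0) else 0)" if "x < N" "s < N" for x s
    using that Ecol[OF that(2,1)] by auto
  have Kent: "?K $$ (x, y) = (if x = y then ?q y else 0)" if "x < N" "y < N" for x y
    using that by (simp add: K_op_def \<rho>_def)
  have oent: "1\<^sub>m N $$ (x, y) = (if x = y then 1 else 0 :: complex)" if "x < N" "y < N" for x y
    using that by simp
  have ent: "?M $$ (x * N + y, z * N + w) = crossing_coeff N x y z w"
    if "x < N" "y < N" "z < N" "w < N" for x y z w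
    using standard_R_check_entry[OF that] by (simp add: \<rho>_def)
  have 1: "(?M * kron ?E ?K) $$ (r, c) = (if j + 1 < N then crossing_coeff N s t (j + 1) k * ?q k else 0)"
  proof -
    have "(?M * kron ?E ?K) $$ (r, j * N + k)
        = (if j + 1 < N \<and> k < N then ?M $$ (r, (j + 1) * N + k) * (1 * ?q k) else 0)"
      by (rule mult_kron_unit_entry[OF M E K r stjk(3,4)]) (use Ecol Kent stjk in auto)
    then show ?thesis unfolding rc using ent[OF stjk(1,2) _ stjk(4), of "j + 1"] stjk by auto
  qed
  have 2: "(?M * kron (1\<^sub>m N) ?E) $$ (r, c) = (if k + 1 < N then crossing_coeff N s t j (k + 1) else 0)"
  proof -
    have "(?M * kron (1\<^sub>m N) ?E) $$ (r, j * N + k)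
        = (if j < N \<and> k + 1 < N then ?M $$ (r, j * N + (k + 1)) * (1 * 1) else 0)"
      by (rule mult_kron_unit_entry[OF M o E r stjk(3,4)]) (use Ecol oent stjk in auto)
    then show ?thesis unfolding rc using ent[OF stjk(1,2,3), of "k + 1"] stjk by auto
  qed
  have 3: "(kron ?E ?K * ?M) $$ (r, c) = (if s > 0 then ?q t * crossing_coeff N (s - 1) t j k else 0)"
  proof -
    have "(kron ?E ?K * ?M) $$ (s * N + t, c)
        = (if s - 1 < N \<and> t < N then ((if s > 0 then 1 else 0) * ?q t) * ?M $$ ((s - 1) * N + t, c) else 0)"
      by (rule kron_unit_mult_entry[OF M E K stjk(1,2) c]) (use Erow Kent stjk in auto)
    then show ?thesis unfolding rc using ent[OF _ stjk(2,3,4), of "s - 1"] stjk by auto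
  qed
  have 4: "(kron (1\<^sub>m N) ?E * ?M) $$ (r, c) = (if t > 0 then crossing_coeff N s (t - 1) j k else 0)"
  proof -
    have "(kron (1\<^sub>m N) ?E * ?M) $$ (s * N + t, c)
        = (if s < N \<and> t - 1 < N then (1 * (if t > 0 then 1 else 0)) * ?M $$ (s * N + (t - 1), c) else 0)"
      by (rule kron_unit_mult_entry[OF M o E stjk(1,2) c]) (use Erow oent stjk in auto)
    then show ?thesis unfolding rc using ent[OF stjk(1) _ stjk(3,4), of "t - 1"] stjk by auto
  qed
  have "(?M * (kron ?E ?K + kron (1\<^sub>m N) ?E)) $$ (r, c)
      = (?M * kron ?E ?K) $$ (r, c) + (?M * kron (1\<^sub>m N) ?E) $$ (r, c)"
    unfolding mult_add_distrib_mat[OF M EK oE]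
    by (rule index_add_mat(1)) (use r c carrier_matD[OF oE] carrier_matD[OF M] in auto)
  also have "\<dots> = (kron ?E ?K * ?M) $$ (r, c) + (kron (1\<^sub>m N) ?E * ?M) $$ (r, c)"
    unfolding 1 2 3 4 using crossing_coeff_swap[OF stjk(3,4,1,2)] by simp
  also have "\<dots> = ((kron ?E ?K + kron (1\<^sub>m N) ?E) * ?M) $$ (r, c)"
    unfolding add_mult_distrib_mat[OF EK oE M]
    by (rule index_add_mat(1)[symmetric]) (use r c carrier_matD[OF oE] carrier_matD[OF M] in auto)
  finally show "(?M * (kron ?E ?K + kron (1\<^sub>m N) ?E)) $$ (r, c)
      = ((kron ?E ?K + kron (1\<^sub>m N) ?E) * ?M) $$ (r, c)" .
qed

lemma inverse_commutes:
  assumes A: "A \<in> carrier_mat n n" and X: "X \<in> carrier_mat n n" and B: "B \<in> carrier_mat n n"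
    and AB: "A * B = 1\<^sub>m n" and BA: "B * A = (1\<^sub>m n :: complex mat)" and comm: "A * X = X * A"
  shows "B * X = X * B"
proof -
  have "B * X = B * (X * (A * B))" using AB right_mult_one_mat[OF X] by simp
  also have "\<dots> = B * ((A * X) * B)" unfolding comm assoc_mult_mat[OF X A B] ..
  also have "\<dots> = (B * A) * (X * B)"
    unfolding assoc_mult_mat[OF A X B] by (rule assoc_mult_mat[symmetric, OF B A mult_carrier_mat[OF X B]])
  also have "\<dots> = X * B" unfolding BA by (rule left_mult_one_mat[OF mult_carrier_mat[OF X B]])
  finally show ?thesis .
qed

lemma standard_diagram_op_commutes_E:
  assumes "odd N" and D: "one_one_tangle_diagram D"
  shows "diagram_op N (semicyclic_rep N 0 0) [Down] D * rep_E (semicyclic_rep N 0 0)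
    = rep_E (semicyclic_rep N 0 0) * diagram_op N (semicyclic_rep N 0 0) [Down] D"
proof -
  let ?\<rho> = "semicyclic_rep N 0 0"
  let ?E = "rep_E ?\<rho>" and ?M = "R_check N ?\<rho>"
  let ?W = "word_E N (strand_E N ?\<rho>) (strand_K N ?\<rho>)"
  have N: "N > 0" using assms(1) by (cases N) auto
  interpret K: scaled_iso N "inverse (q_root N ^ 2)" ?\<rho> ?\<rho> "K_op N ?\<rho>" "K_inv_op N ?\<rho>"
    using scaled_iso_K[OF assms(1)] .
  have E: "?E \<in> carrier_mat N N" by simp
  have sE: "strand_E N ?\<rho> x \<in> carrier_mat N N" for x
    using mult_carrier_mat[OF E K_op_carrier(2)[of N ?\<rho>]] by (cases x) (auto simp: E_dual_op_def)
  have sK: "strand_K N ?\<rho> x \<in> carrier_mat N N" for x by (cases x) auto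
  have W: "?W s \<in> carrier_mat (N ^ length s) (N ^ length s)" for s
    by (rule word_E_carrier) (rule sE sK)+
  have one: "?W [Down] = ?E"
    using right_add_zero_mat[OF E] carrier_matD[OF E] by (simp add: kron_one_right kron_zero)
  have two: "?W [Down, Down] = kron ?E (K_op N ?\<rho>) + kron (1\<^sub>m N) ?E"
    using one by (simp add: kron_one_right)
  have pos: "?M * ?W [Down, Down] = ?W [Down, Down] * ?M"
    unfolding two by (rule standard_R_check_E)
  have piece: "piece_op N ?\<rho> p * ?W (piece_bottom p) = ?W (piece_top p) * piece_op N ?\<rho> p" for p
  proof (cases "p \<in> {CupLR, CupRL, CapLR, CapRL}")
    case True
    then show ?thesis by (intro cups_caps_word_E E)
  next
    case False
    then consider "p = PosCrossing" | "p = NegCrossing" by (cases p) auto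
    then show ?thesis
    proof cases
      case 1
      show ?thesis unfolding 1 piece_op.simps piece_bottom.simps piece_top.simps by (rule pos)
    next
      case 2
      note inv = mat_inverse_of_det_nonzero[OF R_check_carrier det_R_check_nonzero[of N 0]]
      have W2: "?W [Down, Down] \<in> carrier_mat (N * N) (N * N)" using W[of "[Down, Down]"] by simp
      show ?thesis unfolding 2 piece_op.simps piece_bottom.simps piece_top.simps
        by (rule inverse_commutes[OF R_check_carrier W2 inv(3,1,2) pos])
    qed
  qed
  note S = slice_op_carrier[OF det_R_check_nonzero[of N 0]]
  have "diagram_op N ?\<rho> [Down] D * ?W [Down] = ?W [Down] * diagram_op N ?\<rho> [Down] D"
  proof (rule diagram_op_intertwines[OF D[unfolded one_one_tangle_diagram_def] W S S])
    fix x :: slice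
    obtain ls p rs where x: "x = (ls, p, rs)" by (cases x) auto
    show "slice_op N ?\<rho> x * ?W (slice_bottom x) = ?W (slice_top x) * slice_op N ?\<rho> x"
      unfolding x slice_op.simps slice_bottom.simps slice_top.simps
      by (rule slice_op_word_E[OF sE sK piece_op_carrier[OF det_R_check_nonzero] K.piece_op_comm piece])
  qed
  then show ?thesis unfolding one .
qed

text \<open>Compare the coefficients of \<open>v\<^bsub>k+1\<^esub>\<close> in \<open>T E v\<^sub>k\<close> and \<open>E T v\<^sub>k\<close>, where \<open>E v\<^sub>k = v\<^bsub>k+1\<^esub>\<close>.\<close>

lemma standard_diagram_op_scalar:
  assumes "odd N" and D: "one_one_tangle_diagram D" and "k < N"
  shows "diagram_op N (semicyclic_rep N 0 0) [Down] D $$ (k, k)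
    = diagram_op N (semicyclic_rep N 0 0) [Down] D $$ (0, 0)"
  using assms(3)
proof (induction k)
  case (Suc k)
  let ?T = "diagram_op N (semicyclic_rep N 0 0) [Down] D" and ?E = "rep_E (semicyclic_rep N 0 0)"
  have N: "N > 0" using Suc.prems by simp
  note T = semicyclic_diagram_op_carrier[OF D, of N 0]
  have E: "?E $$ (r, c) = (if r = c + 1 then 1 else 0)" if "r < N" "c < N" for r c
    using that by (auto simp: semicyclic_rep_def)
  have "(?T * ?E) $$ (Suc k, k) = (\<Sum>l<N. if l = Suc k then ?T $$ (Suc k, l) else 0)"
    unfolding mult_mat_entry[OF T semicyclic_carrier(1) Suc.prems Suc_lessD[OF Suc.prems]]
    by (rule sum.cong) (use E Suc.prems in auto)
  moreover have "(?E * ?T) $$ (Suc k, k) = (\<Sum>l<N. if l = k then ?T $$ (l, k) else 0)"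
    unfolding mult_mat_entry[OF semicyclic_carrier(1) T Suc.prems Suc_lessD[OF Suc.prems]]
    by (rule sum.cong) (use E Suc.prems in auto)
  ultimately have "?T $$ (Suc k, Suc k) = ?T $$ (k, k)"
    using standard_diagram_op_commutes_E[OF assms(1) D] Suc.prems by simp
  then show ?case using Suc.IH Suc.prems by simp
qed simp

section \<open>Comparison of the two invariants\<close>

text \<open>The isomorphism is monomial and the operator in \<open>\<rho>\<^sub>b\<close> is diagonal, so conjugation only permutes the
  diagonal entries: the scalars \<open>shift_coeff\<close> cancel.\<close>

lemma semicyclic_diagram_op_shift:
  assumes "odd N" "i < N" "a \<noteq> 0" "b \<noteq> 0" and D: "one_one_tangle_diagram D"
    and r: "r < N" and k: "k < N"
  shows "diagram_op N (semicyclic_rep N a i) [Down] D $$ (r, (i + k) mod N)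
    = (if r = (i + k) mod N then diagram_op N (semicyclic_rep N b 0) [Down] D $$ (k, k) else 0)"
proof -
  have N: "N > 0" using k by simp
  \<comment> \<open>an \<open>N\<close>-th root of \<open>a / b\<close>\<close>
  define s where "s = exp (Ln (a / b) / of_nat N)"
  have "s ^ N = exp (of_nat N * (Ln (a / b) / of_nat N))" unfolding s_def by (rule exp_of_nat_mult[symmetric])
  then have sN: "a = s ^ N * b" using N assms(3,4) by simp
  have s0: "s \<noteq> 0" by (simp add: s_def)
  let ?G = "shift_op N a i s 1" and ?H = "dual_shift_op N a i s 1" and ?\<sigma> = "(i + k) mod N"
  interpret scaled_iso N s "semicyclic_rep N b 0" "semicyclic_rep N a i" ?G ?H
    by (rule scaled_iso_shift) (use assms sN s0 in auto)
  let ?T = "diagram_op N (semicyclic_rep N b 0) [Down] D"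
    and ?T' = "diagram_op N (semicyclic_rep N a i) [Down] D"
  note T = semicyclic_diagram_op_carrier[OF D, of N b]
  have T': "?T' \<in> carrier_mat N N"
    using diagram_op_carrier[OF D[unfolded one_one_tangle_diagram_def] slice_op_carrier[OF R_inv']] by simp
  have eq: "?T' * ?G = ?G * ?T"
    using diagram_op_comm[OF D[unfolded one_one_tangle_diagram_def]] by (simp add: kron_one_right)
  have g: "shift_coeff N a i s 1 k \<noteq> 0" using s0 assms(3) by (simp add: shift_coeff_def)
  have "(?T' * ?G) $$ (r, k) = ?T' $$ (r, ?\<sigma>) * shift_coeff N a i s 1 k"
    by (rule mult_monomial_op_entry[OF T' r k]) (use N in simp)
  moreover have "(?G * ?T) $$ (r, k) = (\<Sum>l<N. if l = k then ?G $$ (r, l) * ?T $$ (l, k) else 0)"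
    unfolding mult_mat_entry[OF monomial_op_carrier T r k]
    by (rule sum.cong) (use semicyclic_diagram_op_diagonal[OF assms(1) D _ k] in auto)
  ultimately have "?T' $$ (r, ?\<sigma>) * shift_coeff N a i s 1 k
      = (if r = ?\<sigma> then shift_coeff N a i s 1 k else 0) * ?T $$ (k, k)"
    using eq r k by simp
  then show ?thesis using g by (auto split: if_splits)
qed

text \<open>By the previous lemma the entry at parameter \<open>b\<close> is the same for all \<open>b \<noteq> 0\<close>; continuity extends this
  to \<open>b = 0\<close>.\<close>

lemma semicyclic_diagram_op_parameter_limit:
  assumes "odd N" "i < N" "a \<noteq> 0" and D: "one_one_tangle_diagram D" and k: "k < N"
  shows "diagram_op N (semicyclic_rep N 0 0) [Down] D $$ (k, k)
    = diagram_op N (semicyclic_rep N a i) [Down] D $$ ((i + k) mod N, (i + k) mod N)"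
proof -
  let ?f = "\<lambda>b. diagram_op N (semicyclic_rep N b 0) [Down] D $$ (k, k)"
  let ?c = "diagram_op N (semicyclic_rep N a i) [Down] D $$ ((i + k) mod N, (i + k) mod N)"
  have N: "N > 0" using k by simp
  have "continuous_on UNIV ?f"
    using entrywise_continuousD(2)[OF semicyclic_diagram_op_continuous[OF N
      D[unfolded one_one_tangle_diagram_def]], of k k] k by simp
  then have "isCont ?f 0" by (simp add: continuous_on_eq_continuous_at)
  then have lim: "(?f \<longlongrightarrow> ?f 0) (at 0)" by (simp add: isCont_def)
  have const: "?f b = ?c" if "b \<noteq> 0" for b
    using semicyclic_diagram_op_shift[OF assms(1-3) that D _ k, of "(i + k) mod N"] N by simp
  have lim': "(?f \<longlongrightarrow> ?c) (at 0)"
    by (rule Lim_transform_eventually[OF tendsto_const]) (auto simp: eventually_at_filter const)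
  show ?thesis by (rule tendsto_unique[OF at_neq_bot lim lim'])
qed

theorem theorem6p3:
  fixes N i :: nat and a :: complex and \<K> :: "slice list"
  assumes "N \<ge> 3" and "odd N" and "a \<noteq> 0" and "i < N"
    and "one_one_tangle_diagram \<K>"
  shows "semicyclic_invariant N a i \<K> = kashaev_invariant N \<K>"
proof -
  let ?S = "diagram_op N (semicyclic_rep N a i) [Down] \<K>"
    and ?T = "diagram_op N (semicyclic_rep N 0 0) [Down] \<K>"
  have N: "N > 0" using assms(1) by simp
  \<comment> \<open>the isomorphism with the representation without shift shows that the crossings are invertible\<close>
  interpret scaled_iso N 1 "semicyclic_rep N a 0" "semicyclic_rep N a i"
      "shift_op N a i 1 1" "dual_shift_op N a i 1 1"
    by (rule scaled_iso_shift) (use assms in auto)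
  have S: "?S \<in> carrier_mat N N"
    using diagram_op_carrier[OF assms(5)[unfolded one_one_tangle_diagram_def] slice_op_carrier[OF R_inv']]
    by simp
  note T = semicyclic_diagram_op_carrier[OF assms(5), of N 0]
  have "?S = ?T"
  proof (rule eq_matI)
    fix r c assume "r < dim_row ?T" "c < dim_col ?T"
    then have rc: "r < N" "c < N" using carrier_matD[OF T] by auto
    \<comment> \<open>the index that the cyclic shift by \<open>i\<close> moves to \<open>c\<close>; \<open>N\<close> is added to avoid truncated subtraction\<close>
    define k where "k = (c + N - i) mod N"
    have k: "k < N" "(i + k) mod N = c" using rc assms(4) by (auto simp: k_def mod_if)
    show "?S $$ (r, c) = ?T $$ (r, c)"
    proof (cases "r = c")
      case True
      have "?S $$ (c, c) = ?T $$ (k, k)"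
        using semicyclic_diagram_op_parameter_limit[OF assms(2,4,3,5) k(1)] k(2) by simp
      also have "\<dots> = ?T $$ (c, c)"
        using standard_diagram_op_scalar[OF assms(2,5)] k(1) rc(2) by metis
      finally show ?thesis using True by simp
    next
      case False
      then show ?thesis
        using semicyclic_diagram_op_shift[OF assms(2,4,3,3,5) rc(1) k(1)] k(2)
          semicyclic_diagram_op_diagonal[OF assms(2,5) rc False] by simp
    qed
  qed (use carrier_matD[OF S] carrier_matD[OF T] in auto)
  then show ?thesis
    unfolding semicyclic_invariant_def kashaev_invariant_def standard_rep_eq_semicyclic_rep[OF N] .
qed

end
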